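(* There exists an absolute constant $c>0$ such that for every positive integer $n$, \[\frac{1}{8\sqrt{d(n)}}\cdot \min_{r\mid n}\left(\frac{n}{r}+\sqrt{r}\right)\;\le\; \operatorname{disc}(\mathcal A_n)\;\le\; \min_{r\mid n}\left(\frac{n}{r}+c\sqrt{r}\,2^{\omega(r)}\right),\] where the minima are over positive divisors $r$ of $n$.
   Context: For a positive integer $n$, an arithmetic progression in $\mathbb{Z}_n$ is a set $\{a+kd: 0\le k<l\}$ with $a,d\in\mathbb{Z}_n$ and $l$ an integer with $0\le l\le n/\gcd(n,d)$ (here $\gcd(d,n)$ is computed for any integer representative of $d$, so $\gcd(0,n)=n$). $\mathcal A_n$ denotes the family of all arithmetic progressions in $\mathbb{Z}_n$. For $\chi:\mathbb{Z}_n\to\{1,-1\}$ and $A\subseteq\mathbb{Z}_n$, $\chi(A)=\sum_{x\in A}\chi(x)$, and $\operatorname{disc}(\mathcal A_n)=\min_{\chi:\mathbb{Z}_n\to\{1,-1\}}\max_{A\in\mathcal A_n}|\chi(A)|$. $d(n)$ is the number of positive divisors of $n$ and $\omega(r)$ is the number of distinct prime factors of $r$. *)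

theory Defs
  imports "HOL-Computational_Algebra.Primes" Complex_Main
begin

text \<open>Z_n is represented by the residues {0..<n} (n > 0), with arithmetic mod n.
  An arithmetic progression {a + k d : 0 <= k < l} with a, d in Z_n and
  0 <= l <= n / gcd n d.\<close>

definition arith_progs :: "nat \<Rightarrow> nat set set" where
  "arith_progs n = {{(a + k * d) mod n | k. k < l} | a d l.
      a < n \<and> d < n \<and> l \<le> n div gcd n d}"

definition disc_AP :: "nat \<Rightarrow> int" where
  "disc_AP n = Min {Max {\<bar>\<Sum>x\<in>A. chi x\<bar> | A. A \<in> arith_progs n} |
      chi :: nat \<Rightarrow> int. \<forall>x<n. chi x \<in> {1, -1}}"

definition num_divisors :: "nat \<Rightarrow> nat" where
  "num_divisors n = card {r. r dvd n}"

definition omega :: "nat \<Rightarrow> nat" where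
  "omega r = card (prime_factors r)"

end

theory Submission
  imports Defs "HOL-Library.FuncSet" "HOL-Library.Nat_Bijection" "HOL-Number_Theory.Cong"
begin

text \<open>
  Lower bound. Group the frequencies of a colouring \<open>\<chi>\<close> of \<open>\<int>\<^sub>n\<close> by their gcd with \<open>n\<close>: by Parseval
  some class \<open>gcd \<xi> n = n / r\<close> carries at least the fraction \<open>1 / d(n)\<close> of the Fourier mass.
  Convolving with progressions of difference \<open>r\<close> and length \<open>n / r\<close>, for which these frequencies are in
  phase, gives a progression of discrepancy at least \<open>(n / r) / sqrt d(n)\<close>. Averaging over all differences
  \<open>d\<close> invertible modulo \<open>r\<close> and length about \<open>r / 3\<close>, each such frequency resonates with some \<open>d\<close>,
  which gives \<open>sqrt r / (6 sqrt d(n))\<close>.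

  Upper bound. Pull back a colouring \<open>\<psi>\<close> of \<open>\<int>\<^sub>r\<close>. A progression in \<open>\<int>\<^sub>n\<close> becomes at most \<open>n / r\<close> full
  cosets and one shorter progression, so it suffices that every coset of every subgroup has \<open>\<psi>\<close>-sum
  at most 1 in modulus and every progression of \<open>\<int>\<^sub>r\<close> has \<open>\<psi>\<close>-sum \<open>O(2\<^sup>\<omega> sqrt r)\<close>. The coset
  condition is made automatic by tying points together in signed groups of size at most \<open>2\<^sup>\<omega>\<close>
  (pairs for a prime power, products of pairs by the Chinese remainder theorem); only one free sign per
  group remains. These signs are chosen by iterated partial colouring. The progressions with a fixed
  difference are combinations of boundedly many prefixes of one ordering of \<open>\<int>\<^sub>r\<close>, so only \<open>r\<close> orderings
  matter, and their dyadic blocks are few enough to avoid any logarithmic loss.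
\<close>

section \<open>Partial colouring\<close>

lemma power2_mult_fact_le_fact_double: "2 ^ n * fact n \<le> (fact (2 * n) :: real)"
proof (induction n)
  case (Suc n)
  have "2 ^ Suc n * fact (Suc n) = (2 * real n + 2) * (2 ^ n * fact n)"
    by (simp add: algebra_simps)
  also have "\<dots> \<le> (2 * real n + 2) * fact (2 * n)"
    using Suc by (intro mult_left_mono) auto
  also have "\<dots> \<le> (2 * real n + 2) * ((2 * real n + 1) * fact (2 * n))"
    by (intro mult_left_mono) (auto simp: algebra_simps)
  also have "\<dots> = fact (2 * Suc n)"
    by (simp add: algebra_simps)
  finally show ?case .
qed simp

text \<open>The odd terms of the two exponential series cancel; the even ones are compared term by
  term with the series of exp (x^2 / 2), using 2^n n! \<le> (2n)!.\<close>

lemma exp_plus_exp_minus_le: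
  fixes x :: real
  shows "exp x + exp (- x) \<le> 2 * exp (x\<^sup>2 / 2)"
proof -
  have "(\<lambda>n. x ^ n /\<^sub>R fact n + (- x) ^ n /\<^sub>R fact n) sums (exp x + exp (- x))"
    by (intro sums_add exp_converges)
  from sums_group[OF this, of 2]
  have 1: "(\<lambda>n. 2 * x ^ (2 * n) / fact (2 * n)) sums (exp x + exp (- x))"
  proof (rule sums_cong[THEN iffD1, rotated])
    fix n :: nat
    have "{n * 2..<n * 2 + 2} = {2 * n, Suc (2 * n)}" by auto
    then show "(\<Sum>k = n * 2..<n * 2 + 2. x ^ k /\<^sub>R fact k + (- x) ^ k /\<^sub>R fact k)
        = 2 * x ^ (2 * n) / fact (2 * n)"
      by (simp add: divide_simps)
  qed auto
  have 2: "(\<lambda>n. 2 * ((x\<^sup>2 / 2) ^ n /\<^sub>R fact n)) sums (2 * exp (x\<^sup>2 / 2))"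
    by (intro sums_mult exp_converges)
  show ?thesis
  proof (rule sums_le[OF _ 1 2])
    fix n :: nat
    have "2 * x ^ (2 * n) / fact (2 * n) \<le> 2 * x ^ (2 * n) / (2 ^ n * fact n)"
      by (intro divide_left_mono power2_mult_fact_le_fact_double mult_pos_pos) auto
    also have "\<dots> = 2 * ((x\<^sup>2 / 2) ^ n /\<^sub>R fact n)"
      by (simp add: power_divide power_mult divide_simps)
    finally show "2 * x ^ (2 * n) / fact (2 * n) \<le> 2 * ((x\<^sup>2 / 2) ^ n /\<^sub>R fact n)" .
  qed
qed

text \<open>The sub-Gaussian moment bound for a random signed sum: the sum over all sign vectors
  factors over the coordinates.\<close>

lemma sum_exp_signs_le:
  fixes w :: "'a \<Rightarrow> real"
  assumes "finite U"
  shows "(\<Sum>\<chi>\<in>U \<rightarrow>\<^sub>E {1, -1 :: real}. exp (\<Sum>u\<in>U. w u * \<chi> u))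
    \<le> 2 ^ card U * exp ((\<Sum>u\<in>U. (w u)\<^sup>2) / 2)"
proof -
  have "(\<Sum>\<chi>\<in>U \<rightarrow>\<^sub>E {1, -1 :: real}. exp (\<Sum>u\<in>U. w u * \<chi> u))
      = (\<Prod>u\<in>U. \<Sum>c\<in>{1, -1}. exp (w u * c))"
    using assms by (subst prod_sum_PiE) (auto simp: exp_sum)
  also have "\<dots> \<le> (\<Prod>u\<in>U. 2 * exp ((w u)\<^sup>2 / 2))"
    using exp_plus_exp_minus_le by (intro prod_mono) auto
  also have "\<dots> = 2 ^ card U * exp ((\<Sum>u\<in>U. (w u)\<^sup>2) / 2)"
    using assms by (simp add: prod.distrib exp_sum sum_divide_distrib)
  finally show ?thesis .
qed

lemma abs_round_le_abs:
  fixes z :: real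
  shows "\<bar>real_of_int (round (z / 2))\<bar> \<le> \<bar>z\<bar>"
proof (cases "round (z / 2) = 0")
  case False
  then have "1 \<le> \<bar>real_of_int (round (z / 2))\<bar>" by linarith
  moreover have "\<bar>real_of_int (round (z / 2)) - z / 2\<bar> \<le> 1 / 2"
    by (rule of_int_round_abs_le)
  ultimately show ?thesis by linarith
qed simp

text \<open>The rounded value vanishes unless |z| \<ge> 1, and for such z the linear function |z| is
  below exp (y (|z| - 1)). This turns a mean of rounded values into exponential moments.\<close>

lemma abs_round_le_exp:
  fixes y z :: real
  assumes "1 \<le> y"
  shows "\<bar>real_of_int (round (z / 2))\<bar> \<le> exp (- y) * (exp (y * z) + exp (- (y * z)))"
proof (cases "round (z / 2) = 0")
  case False
  have le: "\<bar>real_of_int (round (z / 2))\<bar> \<le> \<bar>z\<bar>"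
    by (rule abs_round_le_abs)
  with False have z: "1 \<le> \<bar>z\<bar>" by linarith
  have "\<bar>z\<bar> \<le> exp (\<bar>z\<bar> - 1)"
    using exp_ge_add_one_self[of "\<bar>z\<bar> - 1"] by simp
  also have "\<dots> \<le> exp (y * (\<bar>z\<bar> - 1))"
    using z assms by (simp add: mult_le_cancel_right1)
  also have "\<dots> = exp (- y) * exp (y * \<bar>z\<bar>)"
    by (simp add: algebra_simps flip: exp_add)
  also have "\<dots> \<le> exp (- y) * (exp (y * z) + exp (- (y * z)))"
    by (intro mult_left_mono) (auto simp: abs_if)
  finally show ?thesis using le by linarith
qed (simp add: add_nonneg_nonneg)

text \<open>The factor (1 - t) / (1 + t) normalises the two-sided geometric distribution on all
  integers, so a finite window has mass at most 1.\<close>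

lemma sum_geometric_int_le:
  fixes t :: real
  assumes "0 \<le> t" "t < 1"
  shows "(\<Sum>k\<in>{- int N..int N}. (1 - t) / (1 + t) * t ^ nat \<bar>k\<bar>) \<le> 1"
proof -
  have "(\<Sum>k\<in>{- int N..int N}. t ^ nat \<bar>k\<bar>) = 1 + 2 * (\<Sum>k=1..N. t ^ k)"
  proof (induction N)
    case (Suc N)
    have "{- int (Suc N)..int (Suc N)} = insert (- int (Suc N)) (insert (int (Suc N)) {- int N..int N})"
      by auto
    then show ?case using Suc by (simp del: of_nat_Suc)
  qed simp
  also have "(\<Sum>k=1..N. t ^ k) = (t - t ^ Suc N) / (1 - t)"
    using assms by (subst sum_gp) (auto simp: field_simps)
  also have "\<dots> \<le> t / (1 - t)"
    using assms by (intro divide_right_mono) auto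
  finally have "(\<Sum>k\<in>{- int N..int N}. t ^ nat \<bar>k\<bar>) \<le> (1 + t) / (1 - t)"
    using assms by (simp add: field_simps)
  then have "(1 - t) / (1 + t) * (\<Sum>k\<in>{- int N..int N}. t ^ nat \<bar>k\<bar>)
      \<le> (1 - t) / (1 + t) * ((1 + t) / (1 - t))"
    using assms by (intro mult_left_mono) auto
  then show ?thesis using assms by (simp add: sum_distrib_left)
qed

text \<open>The left side bounds the mean of minus the log weight for one constraint: the
  normalisation, plus y / 2 times the mean rounded value. Giving up half of the decay exp (- y / 2)
  absorbs the factor linear in y.\<close>

lemma bucket_cost_le:
  fixes y :: real
  assumes "2 \<le> y" "t = exp (- y / 2)"
  shows "- ln ((1 - t) / (1 + t)) + y / 2 * (2 * exp (- y / 2)) \<le> 4 * exp (- y / 4)"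
proof -
  have "2 \<le> exp (1 :: real)" using exp_ge_add_one_self[of "1::real"] by simp
  also have "\<dots> \<le> exp (y / 2)" using assms by simp
  finally have "inverse (exp (y / 2)) \<le> inverse 2" by (intro le_imp_inverse_le) auto
  then have t: "0 < t" "t \<le> 1 / 2" using assms(2) by (auto simp: exp_minus)
  have "- ln ((1 - t) / (1 + t)) = ln ((1 + t) / (1 - t))"
    using t by (subst ln_div; simp add: ln_div)
  also have "\<dots> \<le> (1 + t) / (1 - t) - 1"
    using t by (intro ln_le_minus_one) auto
  also have "\<dots> \<le> 4 * t" using t by (simp add: field_simps)
  finally have "- ln ((1 - t) / (1 + t)) + y / 2 * (2 * exp (- y / 2)) \<le> 4 * (1 + y / 4) * exp (- y / 2)"
    using assms by (simp add: algebra_simps)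
  also have "\<dots> \<le> 4 * exp (y / 4) * exp (- y / 2)"
    by (intro mult_right_mono mult_left_mono exp_ge_add_one_self) auto
  also have "\<dots> = 4 * exp (- y / 4)" by (simp flip: exp_add)
  finally show ?thesis .
qed

text \<open>A Chernoff-type count of a Hamming ball: charge 1/4 for each disagreement with
  \<open>\<chi>0\<close>. Every close vector has weight at least 4 powr (- card U / 10), while the
  whole cube has weight (5/4) ^ card U.\<close>

lemma card_hamming_close_le:
  assumes "finite U" "\<chi>0 \<in> U \<rightarrow>\<^sub>E {1, -1 :: real}" "C \<subseteq> U \<rightarrow>\<^sub>E {1, -1}"
    and close: "\<And>\<chi>. \<chi> \<in> C \<Longrightarrow> 10 * card {u \<in> U. \<chi> u \<noteq> \<chi>0 u} \<le> card U"
  shows "real (card C) \<le> 4 powr (card U / 10) * (5 / 4) ^ card U"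
proof -
  have fin: "finite (U \<rightarrow>\<^sub>E {1, -1 :: real})" using assms by (intro finite_PiE) auto
  have "real (card C) * 4 powr (- (card U / 10)) = (\<Sum>\<chi>\<in>C. 4 powr (- (card U / 10)))"
    by simp
  also have "\<dots> \<le> (\<Sum>\<chi>\<in>C. \<Prod>u\<in>U. if \<chi> u = \<chi>0 u then 1 else 1 / 4)"
  proof (rule sum_mono)
    fix \<chi> assume "\<chi> \<in> C"
    let ?D = "{u \<in> U. \<chi> u \<noteq> \<chi>0 u}"
    have "4 powr (- (card U / 10)) \<le> (4 :: real) powr (- real (card ?D))"
      using close[OF \<open>\<chi> \<in> C\<close>] by (intro powr_mono) (auto simp: field_simps)
    also have "\<dots> = (1 / 4) ^ card ?D"
      by (simp add: powr_minus powr_realpow power_divide field_simps)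
    also have "\<dots> = (\<Prod>u\<in>U. if \<chi> u = \<chi>0 u then 1 else 1 / 4)"
      using assms(1) by (simp add: prod.If_cases Int_def)
    finally show "4 powr (- (card U / 10)) \<le> (\<Prod>u\<in>U. if \<chi> u = \<chi>0 u then 1 else 1 / 4 :: real)" .
  qed
  also have "\<dots> \<le> (\<Sum>\<chi>\<in>U \<rightarrow>\<^sub>E {1, -1}. \<Prod>u\<in>U. if \<chi> u = \<chi>0 u then 1 else 1 / 4)"
    using assms fin by (intro sum_mono2 prod_nonneg) auto
  also have "\<dots> = (\<Prod>u\<in>U. \<Sum>c\<in>{1, -1}. if c = \<chi>0 u then 1 else 1 / 4)"
    using assms(1) by (subst prod_sum_PiE) auto
  also have "\<dots> = (\<Prod>u\<in>U. 5 / 4)"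
    using assms(2) by (intro prod.cong) (auto simp: PiE_iff)
  finally show ?thesis by (simp add: powr_minus field_simps)
qed

text \<open>Per coordinate, the first two factors are the size of a Hamming ball of radius one tenth
  and exp (1/4) is the entropy loss; a product below 2 means that one ball cannot hold a whole
  rounding class.\<close>

lemma powr_four_tenth_numeric: "(4 :: real) powr (1 / 10) * (5 / 4) * exp (1 / 4) < 2"
proof -
  have "((4 :: real) powr (1 / 10)) ^ 10 = 4"
    by (simp add: powr_power)
  also have "\<dots> \<le> 1.15 ^ 10" by (simp add: power_divide)
  finally have 1: "(4 :: real) powr (1 / 10) \<le> 1.15"
    by (subst (asm) power_mono_iff) auto
  have "exp (1 / 4 :: real) ^ 4 = exp 1" by (simp flip: exp_of_nat_mult)
  also have "\<dots> \<le> 1.32 ^ 4" using exp_le by (simp add: power_divide)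
  finally have 2: "exp (1 / 4 :: real) \<le> 1.32"
    by (subst (asm) power_mono_iff) auto
  have "(4 :: real) powr (1 / 10) * (5 / 4) * exp (1 / 4) \<le> 1.15 * (5 / 4) * 1.32"
    using 1 2 by (intro mult_mono) auto
  also have "\<dots> < (2 :: real)" by simp
  finally show ?thesis .
qed

text \<open>The entropy method without entropy. Round each of the sums \<open>S i \<chi>\<close> to a multiple of
  \<open>2 * lam i * \<sigma> i\<close> and weigh a vector \<open>b\<close> of rounded values by a product \<open>q\<close> of two-sided geometric
  distributions of total mass at most 1. The mean of \<open>q (b \<chi>)\<close> over all sign vectors is at most
  the largest proportion of sign vectors sharing one \<open>b\<close>, and by Jensen it is not small. So some two
  sign vectors with equal \<open>b\<close> are far apart in Hamming distance; take half their difference.\<close>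

lemma partial_coloring:
  fixes v :: "'i \<Rightarrow> 'a \<Rightarrow> real" and \<sigma> lam :: "'i \<Rightarrow> real"
  assumes U: "finite U" "U \<noteq> {}" and I: "finite I"
    and \<sigma>: "\<And>i. i \<in> I \<Longrightarrow> 0 < \<sigma> i" "\<And>i. i \<in> I \<Longrightarrow> (\<Sum>u\<in>U. (v i u)\<^sup>2) \<le> (\<sigma> i)\<^sup>2"
    and lam: "\<And>i. i \<in> I \<Longrightarrow> 0 < lam i" "\<And>i. i \<in> I \<Longrightarrow> 2 \<le> (lam i)\<^sup>2"
    and budget: "(\<Sum>i\<in>I. exp (- (lam i)\<^sup>2 / 4)) \<le> card U / 16"
  shows "\<exists>x :: 'a \<Rightarrow> real. (\<forall>u\<in>U. x u \<in> {-1, 0, 1}) \<and> card U < 10 * card {u\<in>U. x u \<noteq> 0}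
    \<and> (\<forall>i\<in>I. \<bar>\<Sum>u\<in>U. v i u * x u\<bar> \<le> lam i * \<sigma> i)"
proof -
  define m where "m = card U"
  define \<Omega> where "\<Omega> = U \<rightarrow>\<^sub>E {1, -1 :: real}"
  define S where "S = (\<lambda>i \<chi>. \<Sum>u\<in>U. v i u * \<chi> u)"
  define \<Delta> where "\<Delta> = (\<lambda>i. lam i * \<sigma> i)"
  define b where "b = (\<lambda>\<chi>. \<lambda>i\<in>I. round (S i \<chi> / \<Delta> i / 2))"
  define y where "y = (\<lambda>i. (lam i)\<^sup>2)"
  define t where "t = (\<lambda>i. exp (- y i / 2))"
  define q where "q = (\<lambda>i k. (1 - t i) / (1 + t i) * t i ^ nat \<bar>k\<bar>)"
  \<comment> \<open>\<open>X\<close> is minus the logarithm of the weight of the rounded vector. Its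
    mean will be at most \<open>L\<close>, which is the budget card U / 16 times the factor 4 of
    \<open>bucket_cost_le\<close>.\<close>
  define X where "X = (\<lambda>\<chi>. \<Sum>i\<in>I. - ln ((1 - t i) / (1 + t i)) + y i / 2 * \<bar>real_of_int (b \<chi> i)\<bar>)"
  define L where "L = m / 4"
  have \<Delta>: "0 < \<Delta> i" if "i \<in> I" for i using that \<sigma> lam by (simp add: \<Delta>_def)
  have y: "2 \<le> y i" if "i \<in> I" for i using that lam by (simp add: y_def)
  have t: "0 < t i" "t i < 1" if "i \<in> I" for i using y[OF that] by (auto simp: t_def)
  have fin: "finite \<Omega>" unfolding \<Omega>_def using U by (intro finite_PiE) auto
  have card\<Omega>: "card \<Omega> = 2 ^ m" unfolding \<Omega>_def m_def using U by (simp add: card_PiE numeral_2_eq_2)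
  have expX: "(\<Prod>i\<in>I. q i (b \<chi> i)) = exp (- X \<chi>)" for \<chi>
  proof -
    have "exp (- X \<chi>) = (\<Prod>i\<in>I. exp (ln ((1 - t i) / (1 + t i)) - y i / 2 * \<bar>real_of_int (b \<chi> i)\<bar>))"
      using I by (simp add: X_def exp_sum flip: sum_negf)
    also have "\<dots> = (\<Prod>i\<in>I. q i (b \<chi> i))"
    proof (rule prod.cong)
      fix i assume i: "i \<in> I"
      have "exp (- (y i / 2 * \<bar>real_of_int (b \<chi> i)\<bar>)) = t i ^ nat \<bar>b \<chi> i\<bar>"
        unfolding t_def by (simp add: mult_ac flip: exp_of_nat_mult)
      then show "exp (ln ((1 - t i) / (1 + t i)) - y i / 2 * \<bar>real_of_int (b \<chi> i)\<bar>) = q i (b \<chi> i)"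
        using t[OF i] by (simp add: q_def exp_add diff_conv_add_uminus del: add_uminus_conv_diff)
    qed simp
    finally show ?thesis by simp
  qed
  have mean: "(\<Sum>\<chi>\<in>\<Omega>. \<bar>real_of_int (b \<chi> i)\<bar>) \<le> 2 ^ m * (2 * exp (- y i / 2))" if i: "i \<in> I" for i
  proof -
    \<comment> \<open>Since \<open>\<Delta> i\<close> is \<open>lam i * \<sigma> i\<close>, this
      scaling makes the squared norm of \<open>w\<close> at most \<open>y i\<close>. The moments are
      then of size exp (y / 2), which the factor exp (- y) of \<open>abs_round_le_exp\<close>
      outweighs.\<close>
    define w where "w = (\<lambda>u. y i * (v i u / \<Delta> i))"
    have "(\<Sum>u\<in>U. (w u)\<^sup>2) = (y i / \<Delta> i)\<^sup>2 * (\<Sum>u\<in>U. (v i u)\<^sup>2)"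
      by (simp add: w_def sum_distrib_left power_mult_distrib power_divide)
    also have "\<dots> \<le> (y i / \<Delta> i)\<^sup>2 * (\<sigma> i)\<^sup>2"
      using \<sigma> i by (intro mult_left_mono) auto
    also have "\<dots> = y i"
      using \<sigma>(1)[OF i] lam(1)[OF i] by (simp add: \<Delta>_def y_def power_mult_distrib power_divide field_simps power2_eq_square)
    finally have w: "(\<Sum>u\<in>U. (w u)\<^sup>2) \<le> y i" .
    have w_eq: "y i * (S i \<chi> / \<Delta> i) = (\<Sum>u\<in>U. w u * \<chi> u)"
      "- (y i * (S i \<chi> / \<Delta> i)) = (\<Sum>u\<in>U. (- w u) * \<chi> u)" for \<chi>
      by (auto simp: S_def w_def sum_distrib_left sum_divide_distrib sum_negf mult_ac)
    have half: "(\<Sum>\<chi>\<in>\<Omega>. exp (\<Sum>u\<in>U. w' u * \<chi> u)) \<le> 2 ^ m * exp (y i / 2)"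
      if "(\<Sum>u\<in>U. (w' u)\<^sup>2) \<le> y i" for w'
      using sum_exp_signs_le[OF U(1), of w'] that unfolding \<Omega>_def m_def
      by (smt (verit, best) divide_right_mono exp_le_cancel_iff mult_left_mono zero_le_power)
    have "(\<Sum>\<chi>\<in>\<Omega>. \<bar>real_of_int (b \<chi> i)\<bar>)
        \<le> (\<Sum>\<chi>\<in>\<Omega>. exp (- y i) * (exp (\<Sum>u\<in>U. w u * \<chi> u) + exp (\<Sum>u\<in>U. (- w u) * \<chi> u)))"
      unfolding w_eq[symmetric]
    proof (rule sum_mono)
      fix \<chi>
      show "\<bar>real_of_int (b \<chi> i)\<bar> \<le> exp (- y i) * (exp (y i * (S i \<chi> / \<Delta> i)) + exp (- (y i * (S i \<chi> / \<Delta> i))))"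
        using abs_round_le_exp[of "y i" "S i \<chi> / \<Delta> i"] y[OF i] i by (simp add: b_def)
    qed
    also have "\<dots> \<le> exp (- y i) * (2 ^ m * exp (y i / 2) + 2 ^ m * exp (y i / 2))"
      unfolding sum_distrib_left[symmetric] sum.distrib
      using w by (intro mult_left_mono add_mono half) auto
    also have "\<dots> = 2 ^ m * (2 * (exp (- y i) * exp (y i / 2)))" by (simp add: algebra_simps)
    also have "exp (- y i) * exp (y i / 2) = exp (- y i / 2)" by (simp flip: exp_add)
    finally show ?thesis .
  qed
  have "(\<Sum>\<chi>\<in>\<Omega>. X \<chi>) = (\<Sum>i\<in>I. 2 ^ m * (- ln ((1 - t i) / (1 + t i))) + y i / 2 * (\<Sum>\<chi>\<in>\<Omega>. \<bar>real_of_int (b \<chi> i)\<bar>))"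
    unfolding X_def by (subst sum.swap) (simp add: sum.distrib sum_subtractf card\<Omega> sum_distrib_left)
  also have "\<dots> \<le> (\<Sum>i\<in>I. 2 ^ m * (- ln ((1 - t i) / (1 + t i))) + y i / 2 * (2 ^ m * (2 * exp (- y i / 2))))"
    by (intro sum_mono add_left_mono mult_left_mono mean) (auto simp: y_def)
  also have "\<dots> = 2 ^ m * (\<Sum>i\<in>I. - ln ((1 - t i) / (1 + t i)) + y i / 2 * (2 * exp (- y i / 2)))"
    by (simp add: sum_distrib_left algebra_simps)
  also have "\<dots> \<le> 2 ^ m * (\<Sum>i\<in>I. 4 * exp (- y i / 4))"
    using y by (intro mult_left_mono sum_mono bucket_cost_le) (auto simp: t_def)
  also have "\<dots> \<le> 2 ^ m * L"
    using budget by (intro mult_left_mono) (auto simp: y_def L_def m_def simp flip: sum_distrib_left)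
  finally have XL: "(\<Sum>\<chi>\<in>\<Omega>. X \<chi>) \<le> 2 ^ m * L" .
  \<comment> \<open>Jensen for the exponential: the mean of \<open>exp (- X)\<close> is at least \<open>exp (- mean X)\<close>.\<close>
  have "2 ^ m * exp (- L) \<le> exp (- L) * (2 ^ m * (1 + L) - (\<Sum>\<chi>\<in>\<Omega>. X \<chi>))"
    using XL by (simp add: algebra_simps)
  also have "\<dots> = (\<Sum>\<chi>\<in>\<Omega>. exp (- L) * (1 + (L - X \<chi>)))"
    by (simp add: sum_distrib_left[symmetric] sum.distrib sum_subtractf card\<Omega>) (simp add: algebra_simps)
  also have "\<dots> \<le> (\<Sum>\<chi>\<in>\<Omega>. exp (- L) * exp (L - X \<chi>))"
    by (intro sum_mono mult_left_mono exp_ge_add_one_self) auto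
  also have "\<dots> = (\<Sum>\<chi>\<in>\<Omega>. \<Prod>i\<in>I. q i (b \<chi> i))"
    by (simp add: expX flip: exp_add)
  finally have lower: "2 ^ m * exp (- L) \<le> (\<Sum>\<chi>\<in>\<Omega>. \<Prod>i\<in>I. q i (b \<chi> i))" .

  have "\<exists>\<chi>\<in>\<Omega>. \<exists>\<chi>'\<in>\<Omega>. b \<chi> = b \<chi>' \<and> m < 10 * card {u\<in>U. \<chi> u \<noteq> \<chi>' u}"
  proof (rule ccontr)
    assume contra: "\<not> ?thesis"
    \<comment> \<open>If no far pair exists, each rounding class lies in a Hamming ball of radius m
      / 10 around any of its members, so \<open>H\<close> bounds its size.\<close>
    define H where "H = 4 powr (m / 10) * (5 / 4) ^ m"
    have class_le: "real (card {\<chi>\<in>\<Omega>. b \<chi> = \<beta>}) \<le> H" if \<beta>: "\<beta> \<in> b ` \<Omega>" for \<beta>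
    proof -
      obtain \<chi>0 where \<chi>0: "\<chi>0 \<in> \<Omega>" "\<beta> = b \<chi>0" using \<beta> by auto
      show ?thesis
        unfolding H_def m_def
        by (rule card_hamming_close_le[of U \<chi>0]) (use U \<chi>0 contra in \<open>auto simp: \<Omega>_def m_def not_less\<close>)
    qed
    \<comment> \<open>A common bound \<open>N\<close> puts all rounded vectors into a finite box,
      over which the total weight factors into one-dimensional sums.\<close>
    have "finite ((\<lambda>(\<chi>, i). nat \<bar>b \<chi> i\<bar>) ` (\<Omega> \<times> I))" using fin I by auto
    then obtain N where "\<forall>k \<in> (\<lambda>(\<chi>, i). nat \<bar>b \<chi> i\<bar>) ` (\<Omega> \<times> I). k \<le> N"
      unfolding finite_nat_set_iff_bounded_le by blast
    then have N: "nat \<bar>b \<chi> i\<bar> \<le> N" if "\<chi> \<in> \<Omega>" "i \<in> I" for \<chi> i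
      using that by (auto simp: image_iff)
    define B where "B = I \<rightarrow>\<^sub>E {- int N..int N}"
    have finB: "finite B" unfolding B_def using I by (intro finite_PiE) auto
    have bB: "b ` \<Omega> \<subseteq> B"
    proof
      fix \<beta> assume "\<beta> \<in> b ` \<Omega>"
      then obtain \<chi> where "\<chi> \<in> \<Omega>" "\<beta> = b \<chi>" by auto
      with N[of \<chi>] show "\<beta> \<in> B"
        unfolding B_def by (fastforce simp: b_def PiE_iff extensional_def abs_le_iff nat_le_iff)
    qed
    have q0: "0 \<le> q i k" if "i \<in> I" for i k
      using t[OF that] by (simp add: q_def)
    have q1: "(\<Sum>k\<in>{- int N..int N}. q i k) \<le> 1" if "i \<in> I" for i
      unfolding q_def using t[OF that] by (intro sum_geometric_int_le) auto
    have qnn: "0 \<le> (\<Prod>i\<in>I. q i (\<beta> i))" for \<beta>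
      by (intro prod_nonneg q0)
    have "(\<Sum>\<chi>\<in>\<Omega>. \<Prod>i\<in>I. q i (b \<chi> i)) = (\<Sum>\<beta>\<in>b ` \<Omega>. real (card {\<chi>\<in>\<Omega>. b \<chi> = \<beta>}) * (\<Prod>i\<in>I. q i (\<beta> i)))"
      by (subst sum.image_gen[OF fin, of _ b]) (auto intro!: sum.cong)
    also have "\<dots> \<le> (\<Sum>\<beta>\<in>b ` \<Omega>. H * (\<Prod>i\<in>I. q i (\<beta> i)))"
      by (intro sum_mono mult_right_mono class_le qnn)
    also have "\<dots> \<le> (\<Sum>\<beta>\<in>B. H * (\<Prod>i\<in>I. q i (\<beta> i)))"
      using finB bB qnn by (intro sum_mono2) (auto simp: H_def)
    also have "\<dots> = H * (\<Prod>i\<in>I. \<Sum>k\<in>{- int N..int N}. q i k)"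
      unfolding B_def using I by (subst prod_sum_PiE) (auto simp: sum_distrib_left)
    also have "\<dots> \<le> H * (\<Prod>i\<in>I. 1)"
      by (intro mult_left_mono prod_mono conjI sum_nonneg q0 q1) (auto simp: H_def)
    finally have "2 ^ m * exp (- L) \<le> H" using lower by simp
    then have "2 ^ m \<le> H * exp L" by (simp add: exp_minus field_simps)
    also have "\<dots> = (4 powr (1 / 10) * (5 / 4) * exp (1 / 4)) ^ m"
    proof -
      have "4 powr (m / 10) = (4 powr (1 / 10) :: real) ^ m"
        by (simp add: powr_realpow[symmetric] powr_powr)
      moreover have "exp L = exp (1 / 4) ^ m" by (simp add: L_def flip: exp_of_nat_mult)
      ultimately show ?thesis by (simp only: H_def power_mult_distrib)
    qed
    also have "\<dots> < 2 ^ m"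
      using powr_four_tenth_numeric U by (intro power_strict_mono) (auto simp: m_def card_gt_0_iff)
    finally show False by simp
  qed
  then obtain \<chi> \<chi>' where \<chi>: "\<chi> \<in> \<Omega>" "\<chi>' \<in> \<Omega>" "b \<chi> = b \<chi>'" "m < 10 * card {u\<in>U. \<chi> u \<noteq> \<chi>' u}"
    by blast
  define x where "x = (\<lambda>u. (\<chi> u - \<chi>' u) / 2)"
  \<comment> \<open>Equal roundings leave the two sums less than \<open>2 * \<Delta> i\<close>
    apart, and \<open>x\<close> halves the difference.\<close>
  have "\<bar>\<Sum>u\<in>U. v i u * x u\<bar> \<le> lam i * \<sigma> i" if i: "i \<in> I" for i
  proof -
    have "round (S i \<chi> / \<Delta> i / 2) = round (S i \<chi>' / \<Delta> i / 2)"
      using fun_cong[OF \<chi>(3), of i] i by (simp add: b_def)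
    then have "\<bar>S i \<chi> / \<Delta> i / 2 - S i \<chi>' / \<Delta> i / 2\<bar> < 1" by (rule round_eq_imp_diff_1)
    also have "S i \<chi> / \<Delta> i / 2 - S i \<chi>' / \<Delta> i / 2 = (\<Sum>u\<in>U. v i u * x u) / \<Delta> i"
      by (simp add: S_def x_def sum_subtractf[symmetric] sum_divide_distrib diff_divide_distrib algebra_simps)
    finally show ?thesis using \<Delta>[OF i] by (simp add: \<Delta>_def abs_divide)
  qed
  moreover have "\<forall>u\<in>U. x u \<in> {-1, 0, 1}"
    using \<chi>(1,2) by (fastforce simp: \<Omega>_def x_def PiE_iff)
  moreover have "{u\<in>U. x u \<noteq> 0} = {u\<in>U. \<chi> u \<noteq> \<chi>' u}" by (auto simp: x_def)
  ultimately show ?thesis using \<chi>(4) by (intro exI[of _ x]) (auto simp: m_def)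
qed

section \<open>Discrepancy of prefixes\<close>

text \<open>Binary expansion of t: clearing its digits from the lowest upwards removes from {..<t}
  one aligned block of length 2^k for every digit k equal to 1, and nothing remains after J
  digits.\<close>

lemma abs_prefix_sum_le_dyadic:
  fixes h :: "nat \<Rightarrow> real"
  assumes chunk: "\<And>j a. (a + 1) * 2 ^ j \<le> M \<Longrightarrow> \<bar>\<Sum>i = a * 2 ^ j..<(a + 1) * 2 ^ j. h i\<bar> \<le> \<Delta> j"
    and \<Delta>: "\<And>j. 0 \<le> \<Delta> j" and "t \<le> M" "M < 2 ^ J"
  shows "\<bar>\<Sum>i<t. h i\<bar> \<le> (\<Sum>j<J. \<Delta> j)"
proof -
  have "\<bar>(\<Sum>i<t. h i) - (\<Sum>i<(t div 2 ^ k) * 2 ^ k. h i)\<bar> \<le> (\<Sum>j<k. \<Delta> j)" for k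
  proof (induction k)
    case (Suc k)
    define q where "q = t div 2 ^ k"
    have q2: "t div 2 ^ Suc k = q div 2" unfolding q_def power_Suc2 by (rule div_mult2_eq)
    show ?case
    proof (cases "even q")
      case True
      then have e: "(t div 2 ^ Suc k) * 2 ^ Suc k = q * 2 ^ k" unfolding q2 by simp
      show ?thesis using Suc \<Delta>[of k] unfolding e q_def[symmetric] by simp
    next
      case False
      then obtain p where p: "q = 2 * p + 1" by (elim oddE)
      then have e: "(t div 2 ^ Suc k) * 2 ^ Suc k = 2 * p * 2 ^ k" unfolding q2 by simp
      have "(2 * p + 1) * 2 ^ k \<le> M"
        using \<open>t \<le> M\<close> p by (metis q_def order.trans div_times_less_eq_dividend)
      from chunk[OF this] have c: "\<bar>\<Sum>i = 2 * p * 2 ^ k..<q * 2 ^ k. h i\<bar> \<le> \<Delta> k" by (simp add: p)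
      have "(\<Sum>i<q * 2 ^ k. h i) = (\<Sum>i<2 * p * 2 ^ k. h i) + (\<Sum>i = 2 * p * 2 ^ k..<q * 2 ^ k. h i)"
        unfolding lessThan_atLeast0 using p by (intro sum.atLeastLessThan_concat[symmetric]) auto
      then show ?thesis using Suc c unfolding e q_def[symmetric] by simp
    qed
  qed simp
  from this[of J] show ?thesis using assms by simp
qed

text \<open>The factors 4 and 32 powr (1/8) come from the choice of \<open>lam\<close> and
  \<open>\<xi>\<close> in \<open>prefix_partial_coloring\<close>; the last factor comes from a
  geometric series of ratio 2 powr (1/4).\<close>

definition partial_const :: real where
  "partial_const = 4 * 32 powr (1 / 8) * (2 powr (1 / 4) / (2 powr (1 / 4) - 1))"

text \<open>The sum of the errors of all rounds: each round leaves at most 9/10 of the groups, and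
  the error of a round scales with the power 3/8 of their number.\<close>

definition prefix_const :: real where
  "prefix_const = partial_const / (1 - (9 / 10) powr (3 / 8))"

lemma two_powr_quarter_gt_1: "1 < (2 :: real) powr (1 / 4)"
  by simp

lemma partial_const_nonneg: "0 \<le> partial_const"
  using two_powr_quarter_gt_1 unfolding partial_const_def by (intro mult_nonneg_nonneg divide_nonneg_nonneg) (auto intro: less_imp_le)

lemma nine_tenths_powr_lt_1: "(9 / 10 :: real) powr (3 / 8) < 1"
  using powr_less_mono2[of "3 / 8" "9 / 10" "1 :: real"] by simp

lemma prefix_const_nonneg: "0 \<le> prefix_const"
  using partial_const_nonneg nine_tenths_powr_lt_1 by (simp add: prefix_const_def)

text \<open>At level j the weight contributes a multiple of (K m / 2^j) powr (1/4) and the norm sqrt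
  (K 2^j), so the terms grow like 2 powr (j / 4). The longest blocks dominate, and no logarithm of
  the number of levels appears.\<close>

lemma sum_dyadic_deviations_le:
  fixes n m K :: real
  assumes pos: "0 < n" "0 < m" "0 < K" and J: "2 ^ J \<le> 2 * (K * m)"
  shows "(\<Sum>j<J. 4 * (32 * (n / m) * (K * m / 2 ^ j)\<^sup>2) powr (1 / 8) * sqrt (K * 2 ^ j))
    \<le> partial_const * K * n powr (1 / 8) * m powr (3 / 8)"
proof -
  define N where "N = K * m"
  define q :: real where "q = 2 powr (1 / 4)"
  have q: "1 < q" unfolding q_def by (rule two_powr_quarter_gt_1)
  have N: "0 < N" using pos by (simp add: N_def)
  have pq: "(2 ^ j :: real) powr (1 / 4) = q ^ j" for j
    using powr_powr[of 2 "real j" "1 / 4"] powr_powr[of 2 "1 / 4" "real j"]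
    by (simp add: q_def powr_realpow)
  have summand: "4 * (32 * (n / m) * (N / 2 ^ j)\<^sup>2) powr (1 / 8) * sqrt (K * 2 ^ j)
     = 4 * 32 powr (1 / 8) * (n / m) powr (1 / 8) * sqrt K * N powr (1 / 4) * q ^ j" for j
  proof -
    have "((N / 2 ^ j)\<^sup>2) powr (1 / 8) = (N / 2 ^ j) powr (1 / 4)"
      using N powr_powr[of "N / 2 ^ j" 2 "1 / 8"] by (simp add: powr_numeral)
    also have "\<dots> = N powr (1 / 4) / (2 ^ j) powr (1 / 4)" using N by (simp add: powr_divide)
    finally have 1: "((N / 2 ^ j)\<^sup>2) powr (1 / 8) = N powr (1 / 4) / (2 ^ j) powr (1 / 4)" .
    have 2: "sqrt (2 ^ j) = (2 ^ j) powr (1 / 4) * (2 ^ j) powr (1 / 4)"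
      using powr_half_sqrt[of "2 ^ j"] powr_add[of "2 ^ j :: real" "1 / 4" "1 / 4"] by simp
    have 3: "(32 * (n / m) * (N / 2 ^ j)\<^sup>2) powr (1 / 8)
        = 32 powr (1 / 8) * (n / m) powr (1 / 8) * ((N / 2 ^ j)\<^sup>2) powr (1 / 8)"
      using pos powr_mult[of "32 * (n / m)" "(N / 2 ^ j)\<^sup>2" "1 / 8"] powr_mult[of 32 "n / m" "1 / 8"] by simp
    show ?thesis using q unfolding 3 1 real_sqrt_mult 2 pq by simp
  qed
  have "(\<Sum>j<J. 4 * (32 * (n / m) * (N / 2 ^ j)\<^sup>2) powr (1 / 8) * sqrt (K * 2 ^ j))
     = 4 * 32 powr (1 / 8) * (n / m) powr (1 / 8) * sqrt K * N powr (1 / 4) * (\<Sum>j<J. q ^ j)"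
    unfolding summand sum_distrib_left ..
  also have "\<dots> \<le> 4 * 32 powr (1 / 8) * (n / m) powr (1 / 8) * sqrt K * N powr (1 / 4) * (q * N powr (1 / 4) / (q - 1))"
  proof (rule mult_left_mono)
    have "(\<Sum>j<J. q ^ j) = (q ^ J - 1) / (q - 1)" using q geometric_sum[of q J] by simp
    also have "\<dots> \<le> q ^ J / (q - 1)" using q by (intro divide_right_mono) auto
    also have "q ^ J = (2 ^ J) powr (1 / 4)" by (simp add: pq)
    also have "\<dots> \<le> (2 * N) powr (1 / 4)" using J by (intro powr_mono2) (auto simp: N_def)
    also have "\<dots> = q * N powr (1 / 4)" using N by (simp add: powr_mult q_def)
    finally show "(\<Sum>j<J. q ^ j) \<le> q * N powr (1 / 4) / (q - 1)"
      using q by (simp add: divide_right_mono)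
  qed (use pos in auto)
  also have "\<dots> = partial_const * (n / m) powr (1 / 8) * (sqrt K * (N powr (1 / 4) * N powr (1 / 4)))"
    by (simp add: partial_const_def q_def)
  also have "N powr (1 / 4) * N powr (1 / 4) = sqrt N"
    using N powr_half_sqrt[of N] powr_add[of N "1 / 4" "1 / 4"] by simp
  also have "sqrt K * sqrt N = K * m powr (1 / 2)"
    using pos by (simp add: N_def real_sqrt_mult powr_half_sqrt)
  also have "partial_const * (n / m) powr (1 / 8) * (K * m powr (1 / 2))
     = partial_const * K * n powr (1 / 8) * (m powr (1 / 2) / m powr (1 / 8))"
    using pos by (simp add: powr_divide)
  also have "m powr (1 / 2) / m powr (1 / 8) = m powr (3 / 8)"
    using powr_diff[of m "1 / 2" "1 / 8"] by simp
  finally show ?thesis by (simp add: N_def)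
qed

text \<open>The exponent is 4 x powr (1/4), which exceeds ln x. Hence a threshold growing only like
  the eighth root of x uses at most 1 / x of the budget.\<close>

lemma exp_minus_powr_quarter_le:
  fixes x :: real
  assumes "0 < x"
  shows "exp (- ((4 * x powr (1 / 8))\<^sup>2) / 4) \<le> 1 / x"
proof -
  have "(x powr (1 / 8))\<^sup>2 = x powr (1 / 4)" using assms by (simp add: powr_power)
  then have e: "- ((4 * x powr (1 / 8))\<^sup>2) / 4 = - (4 * x powr (1 / 4))"
    by (simp add: power_mult_distrib)
  have "ln x = 4 * ln (x powr (1 / 4))" using assms by (simp add: ln_powr)
  also have "\<dots> \<le> 4 * (x powr (1 / 4) - 1)" using assms by (intro mult_left_mono ln_le_minus_one) auto
  finally have "- (4 * x powr (1 / 4)) \<le> - ln x" by simp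
  then have "exp (- (4 * x powr (1 / 4))) \<le> exp (- ln x)" by simp
  also have "\<dots> = 1 / x" using assms by (simp add: exp_minus inverse_eq_divide)
  finally show ?thesis unfolding e .
qed

section \<open>Choosing group signs that are small on all prefixes of n lists\<close>

lemma filter_take_eq_take_filter: "\<exists>t'\<le>length (filter P xs). filter P (take t xs) = take t' (filter P xs)"
proof -
  have "filter P xs = filter P (take t xs) @ filter P (drop t xs)"
    by (metis append_take_drop_id filter_append)
  then show ?thesis by (intro exI[of _ "length (filter P (take t xs))"]) simp
qed

lemma sum_list_map_take:
  fixes f :: "'a \<Rightarrow> real"
  shows "t \<le> length xs \<Longrightarrow> sum_list (map f (take t xs)) = (\<Sum>i<t. f (xs ! i))"
  by (simp add: sum_list_sum_nth atLeast0LessThan)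

text \<open>In the application \<open>L d\<close> is an ordering of Z_r adapted to the difference d.
  The colour of a point z is the fixed sign \<open>s z\<close> times a free sign attached to its
  group \<open>\<gamma> z\<close>.\<close>

locale grouped_lists =
  fixes X :: "'a set" and L :: "nat \<Rightarrow> 'a list" and n K :: nat
    and \<gamma> :: "'a \<Rightarrow> 'b" and s :: "'a \<Rightarrow> real"
  assumes finite_X: "finite X"
    and lists: "\<And>d. d < n \<Longrightarrow> distinct (L d)" "\<And>d. d < n \<Longrightarrow> set (L d) \<subseteq> X"
    and s_abs: "\<And>z. z \<in> X \<Longrightarrow> \<bar>s z\<bar> \<le> 1"
    and group_card: "\<And>u. card {z\<in>X. \<gamma> z = u} \<le> K"
    and K_pos: "0 < K"
begin

lemma length_filter_group_le:
  assumes "finite U" "d < n"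
  shows "length (filter (\<lambda>z. \<gamma> z \<in> U) (L d)) \<le> K * card U"
proof -
  have "length (filter (\<lambda>z. \<gamma> z \<in> U) (L d)) = card (set (filter (\<lambda>z. \<gamma> z \<in> U) (L d)))"
    using lists(1)[OF assms(2)] by (intro distinct_card[symmetric] distinct_filter)
  also have "\<dots> \<le> card (\<Union>u\<in>U. {z\<in>X. \<gamma> z = u})"
    using lists(2)[OF assms(2)] assms(1) finite_X by (intro card_mono) auto
  also have "\<dots> \<le> (\<Sum>u\<in>U. card {z\<in>X. \<gamma> z = u})"
    by (rule card_UN_le[OF assms(1)])
  also have "\<dots> \<le> (\<Sum>u\<in>U. K)" by (intro sum_mono group_card)
  finally show ?thesis by (simp add: mult.commute)
qed

text \<open>A group meeting the block in c \<le> K points has an entry of modulus at most c, whose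
  square is at most K c; the numbers c add up to the block length. Grouping thus costs a factor K in
  the squared norm.\<close>

lemma sum_square_group_sums_le:
  assumes U: "finite U" and d: "d < n" and Y: "Y = filter (\<lambda>z. \<gamma> z \<in> U) (L d)"
    and R: "finite R" "R \<subseteq> {..<length Y}"
  shows "(\<Sum>u\<in>U. (\<Sum>i\<in>R. if \<gamma> (Y ! i) = u then s (Y ! i) else 0)\<^sup>2) \<le> real K * real (card R)"
proof -
  have YX: "Y ! i \<in> X" "\<gamma> (Y ! i) \<in> U" if "i \<in> R" for i
  proof -
    have "i < length Y" using that R(2) by auto
    then have "Y ! i \<in> set Y" by (rule nth_mem)
    then show "Y ! i \<in> X" "\<gamma> (Y ! i) \<in> U" using lists(2)[OF d] unfolding Y by auto
  qed
  have distY: "distinct Y" using lists(1)[OF d] by (simp add: Y)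
  define c where "c = (\<lambda>u. card {i\<in>R. \<gamma> (Y ! i) = u})"
  have cK: "c u \<le> K" for u
  proof -
    have "c u = card ((!) Y ` {i\<in>R. \<gamma> (Y ! i) = u})"
      unfolding c_def using R(2) by (intro card_image[symmetric] inj_on_nth distY) auto
    also have "\<dots> \<le> card {z\<in>X. \<gamma> z = u}"
      using finite_X YX by (intro card_mono) auto
    finally show ?thesis using group_card[of u] by linarith
  qed
  have "(\<Sum>u\<in>U. (\<Sum>i\<in>R. if \<gamma> (Y ! i) = u then s (Y ! i) else 0)\<^sup>2) \<le> (\<Sum>u\<in>U. real K * real (c u))"
  proof (rule sum_mono)
    fix u
    have "\<bar>\<Sum>i\<in>R. if \<gamma> (Y ! i) = u then s (Y ! i) else 0\<bar> \<le> (\<Sum>i\<in>R. \<bar>if \<gamma> (Y ! i) = u then s (Y ! i) else 0\<bar>)"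
      by (rule sum_abs)
    also have "\<dots> \<le> (\<Sum>i\<in>R. if \<gamma> (Y ! i) = u then 1 else 0)"
      by (intro sum_mono) (simp add: s_abs YX(1))
    also have "\<dots> = c u" using R by (simp add: c_def sum.If_cases Int_def)
    finally have "(\<Sum>i\<in>R. if \<gamma> (Y ! i) = u then s (Y ! i) else 0)\<^sup>2 \<le> (real (c u))\<^sup>2"
      by (subst abs_le_square_iff[symmetric]) simp
    also have "\<dots> \<le> real K * real (c u)"
      unfolding power2_eq_square using cK[of u] by (intro mult_right_mono) auto
    finally show "(\<Sum>i\<in>R. if \<gamma> (Y ! i) = u then s (Y ! i) else 0)\<^sup>2 \<le> real K * real (c u)" .
  qed
  also have "\<dots> = real K * real (\<Sum>u\<in>U. c u)" by (simp add: sum_distrib_left)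
  also have "(\<Sum>u\<in>U. c u) = card R"
    using sum.group[OF R(1) U, of "\<lambda>i. \<gamma> (Y ! i)" "\<lambda>_. 1 :: nat"] YX(2)
    by (simp add: c_def image_subset_iff)
  finally show ?thesis .
qed

text \<open>The vectors are the dyadic blocks of the lists restricted to \<open>U\<close>. The weight \<open>\<xi> j\<close> grows as the
  blocks get shorter so that their deviations sum to a geometric series.\<close>

lemma prefix_partial_coloring:
  assumes U: "finite U" "U \<noteq> {}" "card U \<le> n"
  shows "\<exists>x :: 'b \<Rightarrow> real. (\<forall>u\<in>U. x u \<in> {-1, 0, 1}) \<and> card U < 10 * card {u\<in>U. x u \<noteq> 0}
    \<and> (\<forall>d<n. \<forall>t. \<bar>\<Sum>z\<leftarrow>filter (\<lambda>z. \<gamma> z \<in> U) (take t (L d)). s z * x (\<gamma> z)\<bar>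
        \<le> partial_const * K * n powr (1 / 8) * card U powr (3 / 8))"
proof -
  define m where "m = card U"
  have m: "0 < m" "m \<le> n" using U by (auto simp: m_def card_gt_0_iff)
  define Y where "Y = (\<lambda>d. filter (\<lambda>z. \<gamma> z \<in> U) (L d))"
  have lenY: "length (Y d) \<le> K * m" if "d < n" for d
    unfolding Y_def m_def using length_filter_group_le[OF U(1) that] .
  have Km: "0 < K * m" using m K_pos by simp
  obtain J0 where J0: "2 ^ J0 \<le> K * m" "K * m < 2 ^ (J0 + 1)"
    using ex_power_ivl1[of 2 "K * m"] Km by auto
  define J where "J = J0 + 1"
  have J: "K * m < 2 ^ J" "2 ^ J \<le> 2 * (K * m)" using J0 by (auto simp: J_def)
  have "real (2 ^ J) \<le> real (2 * (K * m))" using J(2) of_nat_le_iff by blast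
  then have J_real: "2 ^ J \<le> 2 * (real K * real m)" by simp
  define I where "I = (SIGMA d:{..<n}. SIGMA j:{..<J}. {a. (a + 1) * 2 ^ j \<le> length (Y d)})"
  define R where "R = (\<lambda>j a. {a * 2 ^ j..<(a + 1) * 2 ^ j :: nat})"
  define v where "v = (\<lambda>(d, j, a) u. \<Sum>i\<in>R j a. if \<gamma> (Y d ! i) = u then s (Y d ! i) else 0)"
  \<comment> \<open>Each constraint will use at most 1 / \<open>\<xi> j\<close> of the budget. There
    are at most n K m / 2^j blocks on level j, so level j uses at most (m / 32) (2^j / (K m)).
    Summed over all levels, with 2^J \<le> 2 K m, this is at most m / 16.\<close>
  define \<xi> where "\<xi> = (\<lambda>j. 32 * (real n / real m) * (real K * real m / 2 ^ j)\<^sup>2)"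
  define lam where "lam = (\<lambda>(d :: nat, j, a :: nat). 4 * \<xi> j powr (1 / 8))"
  define \<sigma> where "\<sigma> = (\<lambda>(d :: nat, j :: nat, a :: nat). sqrt (real K * 2 ^ j))"
  have fin_a: "finite {a. (a + 1) * 2 ^ j \<le> N}" for j N :: nat
  proof (rule finite_subset)
    show "{a. (a + 1) * 2 ^ j \<le> N} \<subseteq> {..N}"
    proof
      fix a assume "a \<in> {a. (a + 1) * 2 ^ j \<le> N}"
      moreover have "(a + 1) * 1 \<le> (a + 1) * 2 ^ j" by (intro mult_left_mono) auto
      ultimately show "a \<in> {..N}" by simp
    qed
  qed simp
  have card_a: "real (card {a. (a + 1) * 2 ^ j \<le> N}) \<le> real N / 2 ^ j" for j N :: nat
  proof -
    have "{a. (a + 1) * 2 ^ j \<le> N} \<subseteq> {..<N div 2 ^ j}"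
      by (auto simp: less_eq_div_iff_mult_less_eq Suc_le_eq[symmetric])
    from card_mono[OF _ this] have "card {a. (a + 1) * 2 ^ j \<le> N} \<le> N div 2 ^ j" by simp
    also have "real (N div 2 ^ j) \<le> real N / real (2 ^ j)" by (rule of_nat_div_le_of_nat)
    finally show ?thesis by simp
  qed
  have \<xi>_ge: "1 \<le> \<xi> j" if "j < J" for j
  proof -
    have "2 ^ j \<le> (2 ^ J0 :: nat)" using that by (intro power_increasing) (auto simp: J_def)
    then have "2 ^ j \<le> K * m" using J0 by linarith
    then have "real (2 ^ j) \<le> real (K * m)" using of_nat_le_iff by blast
    then have "1 \<le> real K * real m / 2 ^ j" by simp
    then have 1: "1 \<le> (real K * real m / 2 ^ j)\<^sup>2" by (rule one_le_power)
    have "1 * 1 \<le> 32 * (real n / real m) * (real K * real m / 2 ^ j)\<^sup>2"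
      using m 1 by (intro mult_mono) (auto simp: field_simps)
    then show ?thesis by (simp add: \<xi>_def)
  qed
  have finI: "finite I" unfolding I_def using fin_a by (intro finite_SigmaI) auto
  have "(\<Sum>i\<in>I. exp (- (lam i)\<^sup>2 / 4)) \<le> (\<Sum>(d, j, a)\<in>I. 1 / \<xi> j)"
  proof (rule sum_mono, clarify)
    fix d j a assume "(d, j, a) \<in> I"
    then have "0 < \<xi> j" using \<xi>_ge[of j] by (auto simp: I_def)
    from exp_minus_powr_quarter_le[OF this]
    show "exp (- (lam (d, j, a))\<^sup>2 / 4) \<le> 1 / \<xi> j" by (simp add: lam_def)
  qed
  also have "\<dots> = (\<Sum>d<n. \<Sum>j<J. real (card {a. (a + 1) * 2 ^ j \<le> length (Y d)}) * (1 / \<xi> j))"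
    unfolding I_def using fin_a by (simp add: sum.Sigma[symmetric])
  also have "\<dots> \<le> (\<Sum>d<n. \<Sum>j<J. (real K * real m / 2 ^ j) * (1 / \<xi> j))"
  proof (intro sum_mono mult_right_mono)
    fix d j assume d: "d \<in> {..<n}" and j: "j \<in> {..<J}"
    have "real (card {a. (a + 1) * 2 ^ j \<le> length (Y d)}) \<le> real (length (Y d)) / 2 ^ j"
      by (rule card_a)
    also have "\<dots> \<le> real (K * m) / 2 ^ j"
      using lenY[of d] d by (intro divide_right_mono) (auto simp del: of_nat_mult)
    finally show "real (card {a. (a + 1) * 2 ^ j \<le> length (Y d)}) \<le> real K * real m / 2 ^ j" by simp
    show "0 \<le> 1 / \<xi> j" using \<xi>_ge[of j] j by simp
  qed
  also have "\<dots> = (\<Sum>j<J. real m / 32 * (2 ^ j / (real K * real m)))"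
  proof -
    have "real n * ((real K * real m / 2 ^ j) * (1 / \<xi> j)) = real m / 32 * (2 ^ j / (real K * real m))" for j
      using m K_pos by (simp add: \<xi>_def power2_eq_square divide_simps)
    then show ?thesis by (simp only: sum_constant card_lessThan sum_distrib_left)
  qed
  also have "\<dots> = real m / 32 * ((2 ^ J - 1) / (real K * real m))"
    using geometric_sum[of "2 :: real" J] unfolding sum_distrib_left[symmetric] sum_divide_distrib[symmetric] by simp
  also have "\<dots> \<le> real m / 32 * 2"
    using J_real m K_pos by (intro mult_left_mono) (auto simp: divide_le_eq)
  finally have budget: "(\<Sum>i\<in>I. exp (- (lam i)\<^sup>2 / 4)) \<le> card U / 16" by (simp add: m_def)
  have RI: "R j a \<subseteq> {..<length (Y d)}" "d < n" "j < J" if "(d, j, a) \<in> I" for d j a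
    using that by (auto simp: I_def R_def)
  have "\<exists>x :: 'b \<Rightarrow> real. (\<forall>u\<in>U. x u \<in> {-1, 0, 1}) \<and> card U < 10 * card {u\<in>U. x u \<noteq> 0}
    \<and> (\<forall>i\<in>I. \<bar>\<Sum>u\<in>U. v i u * x u\<bar> \<le> lam i * \<sigma> i)"
  proof (rule partial_coloring[OF U(1,2) finI _ _ _ _ budget])
    fix i assume "i \<in> I"
    then obtain d j a where i: "i = (d, j, a)" "(d, j, a) \<in> I" by (cases i) auto
    show "0 < \<sigma> i" using K_pos by (simp add: i \<sigma>_def)
    have "(\<Sum>u\<in>U. (v i u)\<^sup>2) \<le> real K * real (card (R j a))"
      unfolding i v_def prod.case
      using sum_square_group_sums_le[OF U(1) RI(2)[OF i(2)] _ _ RI(1)[OF i(2)]] by (simp add: Y_def R_def)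
    then show "(\<Sum>u\<in>U. (v i u)\<^sup>2) \<le> (\<sigma> i)\<^sup>2" by (simp add: i \<sigma>_def R_def)
    have "1 \<le> \<xi> j powr (1 / 8)" using \<xi>_ge[OF RI(3)[OF i(2)]] by (simp add: ge_one_powr_ge_zero)
    then have "4 \<le> lam i" by (simp add: i lam_def)
    then show "0 < lam i" "2 \<le> (lam i)\<^sup>2" using power_mono[of 4 "lam i" 2] by auto
  qed
  then obtain x where x: "\<forall>u\<in>U. x u \<in> {-1, 0, 1}" "card U < 10 * card {u\<in>U. x u \<noteq> 0}"
    "\<And>i. i \<in> I \<Longrightarrow> \<bar>\<Sum>u\<in>U. v i u * x u\<bar> \<le> lam i * \<sigma> i" by blast
  have "\<bar>\<Sum>z\<leftarrow>filter (\<lambda>z. \<gamma> z \<in> U) (take t (L d)). s z * x (\<gamma> z)\<bar>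
        \<le> partial_const * K * n powr (1 / 8) * card U powr (3 / 8)" if d: "d < n" for d t
  proof -
    define h where "h = (\<lambda>i. s (Y d ! i) * x (\<gamma> (Y d ! i)))"
    define \<Delta> where "\<Delta> = (\<lambda>j. 4 * \<xi> j powr (1 / 8) * sqrt (real K * 2 ^ j))"
    obtain t' where t': "t' \<le> length (Y d)" "filter (\<lambda>z. \<gamma> z \<in> U) (take t (L d)) = take t' (Y d)"
      unfolding Y_def using filter_take_eq_take_filter by blast
    have "(\<Sum>z\<leftarrow>filter (\<lambda>z. \<gamma> z \<in> U) (take t (L d)). s z * x (\<gamma> z)) = (\<Sum>i<t'. h i)"
      unfolding t'(2) h_def using t'(1) by (rule sum_list_map_take)
    also have "\<bar>\<dots>\<bar> \<le> (\<Sum>j<J. \<Delta> j)"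
    proof (rule abs_prefix_sum_le_dyadic[OF _ _ t'(1)])
      fix j a assume a: "(a + 1) * 2 ^ j \<le> length (Y d)"
      have "(2 :: nat) ^ j \<le> (a + 1) * 2 ^ j" by simp
      then have "(2 :: nat) ^ j < 2 ^ J" using a lenY[OF d] J by linarith
      then have "j < J" by simp
      then have I: "(d, j, a) \<in> I" using d a by (simp add: I_def)
      \<comment> \<open>Every position of the block belongs to exactly one group of
        \<open>U\<close>, so pairing the block vector with \<open>x\<close> gives the signed sum
        over the block.\<close>
      have "(\<Sum>u\<in>U. v (d, j, a) u * x u) = (\<Sum>i\<in>R j a. \<Sum>u\<in>U. (if \<gamma> (Y d ! i) = u then s (Y d ! i) else 0) * x u)"
        unfolding v_def prod.case sum_distrib_right by (rule sum.swap)
      also have "\<dots> = (\<Sum>i\<in>R j a. h i)"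
      proof (rule sum.cong)
        fix i assume "i \<in> R j a"
        then have "Y d ! i \<in> set (Y d)" using RI(1)[OF I] by auto
        then have "\<gamma> (Y d ! i) \<in> U" by (simp add: Y_def)
        moreover have "(\<Sum>u\<in>U. (if \<gamma> (Y d ! i) = u then s (Y d ! i) else 0) * x u)
            = (\<Sum>u\<in>U. if \<gamma> (Y d ! i) = u then s (Y d ! i) * x u else 0)"
          by (intro sum.cong) auto
        ultimately show "(\<Sum>u\<in>U. (if \<gamma> (Y d ! i) = u then s (Y d ! i) else 0) * x u) = h i"
          using U(1) by (simp add: h_def)
      qed simp
      finally show "\<bar>\<Sum>i = a * 2 ^ j..<(a + 1) * 2 ^ j. h i\<bar> \<le> \<Delta> j"
        using x(3)[OF I] by (simp add: R_def lam_def \<sigma>_def \<Delta>_def)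
    qed (use lenY[OF d] J in \<open>auto simp: \<Delta>_def\<close>)
    also have "\<dots> \<le> partial_const * K * n powr (1 / 8) * m powr (3 / 8)"
      unfolding \<Delta>_def \<xi>_def using m K_pos J_real by (intro sum_dyadic_deviations_le) auto
    finally show ?thesis by (simp add: m_def)
  qed
  with x(1,2) show ?thesis by (intro exI[of _ x] conjI allI impI) simp_all
qed

text \<open>Induction on the number of groups without a sign: a partial colouring settles more than
  a tenth of them, and the rest \<open>V\<close> is treated recursively. The number n of lists stays
  fixed, but the power 3/8 of the number of groups makes the errors decay geometrically.\<close>

lemma prefix_coloring_aux:
  assumes "finite U" "card U \<le> n"
  shows "\<exists>\<epsilon> :: 'b \<Rightarrow> real. (\<forall>u\<in>U. \<epsilon> u \<in> {-1, 1})
    \<and> (\<forall>d<n. \<forall>t. \<bar>\<Sum>z\<leftarrow>filter (\<lambda>z. \<gamma> z \<in> U) (take t (L d)). s z * \<epsilon> (\<gamma> z)\<bar>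
        \<le> prefix_const * K * n powr (1 / 8) * card U powr (3 / 8))"
  using assms
proof (induction "card U" arbitrary: U rule: less_induct)
  case less
  show ?case
  proof (cases "U = {}")
    case True
    then show ?thesis using prefix_const_nonneg by auto
  next
    case False
    obtain x where x: "\<forall>u\<in>U. x u \<in> {-1, 0, 1 :: real}" "card U < 10 * card {u\<in>U. x u \<noteq> 0}"
      "\<And>d t. d < n \<Longrightarrow> \<bar>\<Sum>z\<leftarrow>filter (\<lambda>z. \<gamma> z \<in> U) (take t (L d)). s z * x (\<gamma> z)\<bar>
        \<le> partial_const * K * n powr (1 / 8) * card U powr (3 / 8)"
      using prefix_partial_coloring[OF less(2) False less(3)] by blast
    define V where "V = {u\<in>U. x u = 0}"
    have "V \<union> {u\<in>U. x u \<noteq> 0} = U" "V \<inter> {u\<in>U. x u \<noteq> 0} = {}" by (auto simp: V_def)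
    then have cardV: "card V + card {u\<in>U. x u \<noteq> 0} = card U"
      using less(2) by (metis card_Un_disjoint finite_Un)
    have finV: "finite V" using less(2) by (simp add: V_def)
    have VU: "card V < card U" using cardV x(2) by linarith
    then have "card V \<le> n" using less(3) by linarith
    from less(1)[OF VU finV this] obtain \<epsilon> where \<epsilon>: "\<forall>u\<in>V. \<epsilon> u \<in> {-1, 1 :: real}"
      "\<And>d t. d < n \<Longrightarrow> \<bar>\<Sum>z\<leftarrow>filter (\<lambda>z. \<gamma> z \<in> V) (take t (L d)). s z * \<epsilon> (\<gamma> z)\<bar>
        \<le> prefix_const * K * n powr (1 / 8) * card V powr (3 / 8)"
      by blast
    define \<eta> where "\<eta> = (\<lambda>u. if u \<in> V then \<epsilon> u else x u)"
    have split: "(\<Sum>z\<leftarrow>filter (\<lambda>z. \<gamma> z \<in> U) zs. s z * \<eta> (\<gamma> z))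
      = (\<Sum>z\<leftarrow>filter (\<lambda>z. \<gamma> z \<in> U) zs. s z * x (\<gamma> z)) + (\<Sum>z\<leftarrow>filter (\<lambda>z. \<gamma> z \<in> V) zs. s z * \<epsilon> (\<gamma> z))" for zs
      by (induction zs) (auto simp: \<eta>_def V_def algebra_simps)
    define B where "B = real K * n powr (1 / 8)"
    have B: "0 \<le> B" by (simp add: B_def)
    \<comment> \<open>\<open>prefix_const\<close> solves c = \<open>partial_const\<close> + (9/10)
      powr (3/8) * c, which is what closes the induction.\<close>
    have bound: "partial_const * B * card U powr (3 / 8) + prefix_const * B * card V powr (3 / 8)
        \<le> prefix_const * B * card U powr (3 / 8)"
    proof -
      have "real (card V) \<le> 9 / 10 * card U" using cardV x(2) by linarith
      then have "card V powr (3 / 8) \<le> (9 / 10 * card U) powr (3 / 8)" by (intro powr_mono2) auto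
      also have "\<dots> = (9 / 10) powr (3 / 8) * card U powr (3 / 8)" by (rule powr_mult)
      finally have "prefix_const * B * card V powr (3 / 8)
          \<le> prefix_const * B * ((9 / 10) powr (3 / 8) * card U powr (3 / 8))"
        using prefix_const_nonneg B by (intro mult_left_mono) auto
      moreover have p: "partial_const = prefix_const * (1 - (9 / 10) powr (3 / 8))"
        using nine_tenths_powr_lt_1 by (simp add: prefix_const_def)
      ultimately show ?thesis unfolding p by (simp add: algebra_simps)
    qed
    have "\<bar>\<Sum>z\<leftarrow>filter (\<lambda>z. \<gamma> z \<in> U) (take t (L d)). s z * \<eta> (\<gamma> z)\<bar>
        \<le> prefix_const * K * n powr (1 / 8) * card U powr (3 / 8)" if "d < n" for d t
      using x(3)[OF that, of t] \<epsilon>(2)[OF that, of t] bound unfolding split B_def by (simp add: mult_ac)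
    moreover have "\<forall>u\<in>U. \<eta> u \<in> {-1, 1}" using x(1) \<epsilon>(1) by (auto simp: \<eta>_def V_def)
    ultimately show ?thesis by (intro exI[of _ \<eta>] conjI allI impI) simp_all
  qed
qed

lemma prefix_coloring:
  assumes "card X \<le> n"
  shows "\<exists>\<epsilon> :: 'b \<Rightarrow> real. (\<forall>u. \<epsilon> u \<in> {-1, 1})
    \<and> (\<forall>d<n. \<forall>t. \<bar>\<Sum>z\<leftarrow>take t (L d). s z * \<epsilon> (\<gamma> z)\<bar> \<le> prefix_const * K * sqrt n)"
proof -
  have card_le: "card (\<gamma> ` X) \<le> n" using card_image_le[OF finite_X, of \<gamma>] assms by linarith
  obtain \<epsilon> where \<epsilon>: "\<forall>u\<in>\<gamma> ` X. \<epsilon> u \<in> {-1, 1 :: real}"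
    "\<And>d t. d < n \<Longrightarrow> \<bar>\<Sum>z\<leftarrow>filter (\<lambda>z. \<gamma> z \<in> \<gamma> ` X) (take t (L d)). s z * \<epsilon> (\<gamma> z)\<bar>
        \<le> prefix_const * K * n powr (1 / 8) * card (\<gamma> ` X) powr (3 / 8)"
    using prefix_coloring_aux[of "\<gamma> ` X"] finite_X card_le by auto
  \<comment> \<open>Groups without points receive the sign 1, so that \<open>\<eta>\<close> is a
    sign everywhere.\<close>
  define \<eta> where "\<eta> = (\<lambda>u. if u \<in> \<gamma> ` X then \<epsilon> u else 1)"
  have "\<bar>\<Sum>z\<leftarrow>take t (L d). s z * \<eta> (\<gamma> z)\<bar> \<le> prefix_const * K * sqrt n" if d: "d < n" for d t
  proof -
    have sub: "set (take t (L d)) \<subseteq> X" using lists(2)[OF d] set_take_subset by fastforce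
    then have f: "filter (\<lambda>z. \<gamma> z \<in> \<gamma> ` X) (take t (L d)) = take t (L d)"
      by (intro filter_True) auto
    have "(\<Sum>z\<leftarrow>take t (L d). s z * \<eta> (\<gamma> z)) = (\<Sum>z\<leftarrow>take t (L d). s z * \<epsilon> (\<gamma> z))"
      using sub by (intro arg_cong[where f = sum_list] map_cong) (auto simp: \<eta>_def)
    then have "\<bar>\<Sum>z\<leftarrow>take t (L d). s z * \<eta> (\<gamma> z)\<bar>
        \<le> prefix_const * K * n powr (1 / 8) * card (\<gamma> ` X) powr (3 / 8)"
      using \<epsilon>(2)[OF d, of t] unfolding f by simp
    also have "\<dots> \<le> prefix_const * K * n powr (1 / 8) * n powr (3 / 8)"
      using card_le prefix_const_nonneg by (intro mult_left_mono powr_mono2) auto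
    also have "\<dots> = prefix_const * K * sqrt n"
      using powr_half_sqrt[of "real n"] powr_add[of "real n" "1 / 8" "3 / 8"] by simp
    finally show ?thesis .
  qed
  moreover have "\<forall>u. \<eta> u \<in> {-1, 1}" using \<epsilon>(1) by (auto simp: \<eta>_def)
  ultimately show ?thesis by (intro exI[of _ \<eta>] conjI allI impI) simp_all
qed

end

section \<open>Signed groups balanced on cosets\<close>

text \<open>For g dividing a positive r, the sets x mod g = y are the cosets of the subgroups of
  Z_r, or empty. Taking absolute values group by group keeps a coset sum within 1 for every later
  choice of one sign per group.\<close>

definition balanced_grouping :: "nat \<Rightarrow> nat \<Rightarrow> (nat \<Rightarrow> nat) \<Rightarrow> (nat \<Rightarrow> int) \<Rightarrow> bool" where
  "balanced_grouping r K \<gamma> s \<longleftrightarrow> (\<forall>x<r. s x \<in> {1, -1}) \<and> (\<forall>u. card {x. x < r \<and> \<gamma> x = u} \<le> K)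
    \<and> (\<forall>g y. g dvd r \<longrightarrow> (\<Sum>u\<in>\<gamma> ` {..<r}. \<bar>\<Sum>x | x < r \<and> x mod g = y \<and> \<gamma> x = u. s x\<bar>) \<le> 1)"

lemma sum_le_sum_superset:
  fixes f :: "'a \<Rightarrow> int"
  assumes "finite T" "finite V" "\<And>u. 0 \<le> f u" "\<And>u. u \<in> T - V \<Longrightarrow> f u = 0"
  shows "sum f T \<le> sum f V"
proof -
  have "sum f T = sum f (T \<inter> V)" using assms by (intro sum.mono_neutral_right) auto
  also have "\<dots> \<le> sum f V" using assms by (intro sum_mono2) auto
  finally show ?thesis .
qed

lemma sum_abs_group_sums_le_card:
  fixes r g y :: nat
  assumes "\<And>x. x < r \<Longrightarrow> s x \<in> {1, -1 :: int}"
  shows "(\<Sum>u\<in>\<gamma> ` {..<r}. \<bar>\<Sum>x | x < r \<and> x mod g = y \<and> \<gamma> x = u. s x\<bar>) \<le> int (card {x. x < r \<and> x mod g = y})"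
proof -
  have "(\<Sum>u\<in>\<gamma> ` {..<r}. \<bar>\<Sum>x | x < r \<and> x mod g = y \<and> \<gamma> x = u. s x\<bar>)
      \<le> (\<Sum>u\<in>\<gamma> ` {..<r}. \<Sum>x | x \<in> {x. x < r \<and> x mod g = y} \<and> \<gamma> x = u. 1)"
  proof (rule sum_mono)
    fix u
    have "\<bar>\<Sum>x | x < r \<and> x mod g = y \<and> \<gamma> x = u. s x\<bar> \<le> (\<Sum>x | x < r \<and> x mod g = y \<and> \<gamma> x = u. \<bar>s x\<bar>)"
      by (rule sum_abs)
    also have "\<dots> = (\<Sum>x | x < r \<and> x mod g = y \<and> \<gamma> x = u. 1)"
      using assms by (intro sum.cong) fastforce+
    finally show "\<bar>\<Sum>x | x < r \<and> x mod g = y \<and> \<gamma> x = u. s x\<bar>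
        \<le> (\<Sum>x | x \<in> {x. x < r \<and> x mod g = y} \<and> \<gamma> x = u. 1)" by (simp add: conj_assoc)
  qed
  also have "\<dots> = (\<Sum>x | x < r \<and> x mod g = y. 1)"
    by (rule sum.group) auto
  finally show ?thesis by simp
qed

text \<open>Cosets of a subgroup of \<open>\<int>\<^sub>q\<^sub>p\<close> whose index divides \<open>q\<close> consist of whole fibres of
  reduction modulo \<open>q\<close>; pairing off each fibre, up to one point when \<open>p\<close> is odd, leaves a copy
  of a coset in \<open>\<int>\<^sub>q\<close>.\<close>

lemma balanced_grouping_mult:
  assumes bal: "balanced_grouping q 2 \<gamma> s" and pq: "0 < q" "0 < p"
    and dvd: "\<And>g. g dvd q * p \<Longrightarrow> g dvd q \<or> g = q * p"
  shows "\<exists>\<gamma>' s'. balanced_grouping (q * p) 2 \<gamma>' s'"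
proof -
  define r where "r = q * p"
  \<comment> \<open>Write x = y + q t with y < q. Over each y the points t = 2c and t = 2c + 1 form
    a pair with opposite signs and an odd label encoding (y, c). For odd p the point t = p - 1 has
    no partner; it takes an even label and the sign of y from the grouping modulo q.\<close>
  define left where "left = (\<lambda>t :: nat. even t \<and> t + 1 = p)"
  define \<gamma>' where "\<gamma>' = (\<lambda>x. if left (x div q) then 2 * \<gamma> (x mod q)
    else 2 * prod_encode (x mod q, x div q div 2) + 1)"
  define s' where "s' = (\<lambda>x. if left (x div q) then s (x mod q) else if even (x div q) then 1 else -1 :: int)"
  have s: "\<And>x. x < q \<Longrightarrow> s x \<in> {1, -1}"
    and cardK: "\<And>u. card {x. x < q \<and> \<gamma> x = u} \<le> 2"
    and coset: "\<And>g y. g dvd q \<Longrightarrow> (\<Sum>u\<in>\<gamma> ` {..<q}. \<bar>\<Sum>x | x < q \<and> x mod g = y \<and> \<gamma> x = u. s x\<bar>) \<le> 1"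
    using bal unfolding balanced_grouping_def by blast+
  have s': "s' x \<in> {1, -1}" for x
    using s[of "x mod q"] pq by (auto simp: s'_def)
  have dm: "(y + q * t) div q = t" "(y + q * t) mod q = y" if "y < q" for y t
    using that by auto
  have lt_r: "y + q * t < r \<longleftrightarrow> t < p" if "y < q" for y t
    using that pq by (simp add: r_def mult.commute[of q p] dm flip: div_less_iff_less_mult)
  have half: "t = 2 * (t div 2) \<or> t = 2 * (t div 2) + 1" for t :: nat by presburger
  have x_eq: "x = x mod q + q * (x div q)" for x by simp
  have odd_set: "{x. x < r \<and> x mod g = y \<and> \<gamma>' x = 2 * prod_encode (z, c) + 1}
      = (if z < q \<and> z mod g = y \<and> 2 * c + 1 < p then {z + q * (2 * c), z + q * (2 * c + 1)} else {})"
    if g: "g dvd q" for g y z c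
  proof -
    have iff: "x < r \<and> x mod g = y \<and> \<gamma>' x = 2 * prod_encode (z, c) + 1 \<longleftrightarrow>
       z < q \<and> z mod g = y \<and> 2 * c + 1 < p \<and> (x = z + q * (2 * c) \<or> x = z + q * (2 * c + 1))" for x
    proof
      assume a: "x < r \<and> x mod g = y \<and> \<gamma>' x = 2 * prod_encode (z, c) + 1"
      have nl: "\<not> left (x div q)"
      proof
        assume "left (x div q)"
        then have "\<gamma>' x = 2 * \<gamma> (x mod q)" by (simp add: \<gamma>'_def)
        with a show False by presburger
      qed
      then have zc: "z = x mod q" "c = x div q div 2" using a by (auto simp: \<gamma>'_def)
      have "z < q" using zc pq by simp
      moreover have "z mod g = y" using a zc g by (simp add: mod_mod_cancel)
      moreover have "x div q < p" using a pq lt_r[of "x mod q" "x div q"] by simp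
      moreover have "x div q = 2 * c \<or> x div q = 2 * c + 1" unfolding zc(2) by (rule half)
      moreover have "2 * c + 1 < p"
        using nl calculation(3,4) by (auto simp: left_def)
      ultimately show "z < q \<and> z mod g = y \<and> 2 * c + 1 < p \<and> (x = z + q * (2 * c) \<or> x = z + q * (2 * c + 1))"
        using x_eq[of x] zc(1) by metis
    next
      assume a: "z < q \<and> z mod g = y \<and> 2 * c + 1 < p \<and> (x = z + q * (2 * c) \<or> x = z + q * (2 * c + 1))"
      then obtain t where t: "x = z + q * t" "t = 2 * c \<or> t = 2 * c + 1" by blast
      have "x div q = t" "x mod q = z" using dm a t by auto
      moreover have "x < r" using lt_r[of z t] a t by auto
      moreover have "x mod g = y" using a g calculation(2) by (metis mod_mod_cancel)
      moreover have "\<not> left t" "t div 2 = c" using a t(2) by (auto simp: left_def)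
      ultimately show "x < r \<and> x mod g = y \<and> \<gamma>' x = 2 * prod_encode (z, c) + 1"
        by (simp add: \<gamma>'_def)
    qed
    show ?thesis unfolding iff by auto
  qed
  have even_set: "{x. x < r \<and> x mod g = y \<and> \<gamma>' x = 2 * w}
      = (if odd p then (\<lambda>z. z + q * (p - 1)) ` {z. z < q \<and> z mod g = y \<and> \<gamma> z = w} else {})"
    if g: "g dvd q" for g y w
  proof -
    have iff: "x < r \<and> x mod g = y \<and> \<gamma>' x = 2 * w \<longleftrightarrow>
       odd p \<and> (\<exists>z. z < q \<and> z mod g = y \<and> \<gamma> z = w \<and> x = z + q * (p - 1))" for x
    proof
      assume a: "x < r \<and> x mod g = y \<and> \<gamma>' x = 2 * w"
      have l: "left (x div q)"
      proof (rule ccontr)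
        assume "\<not> left (x div q)"
        then have "\<gamma>' x = 2 * prod_encode (x mod q, x div q div 2) + 1" by (simp add: \<gamma>'_def)
        with a show False by presburger
      qed
      then have "x div q = p - 1" "odd p" by (auto simp: left_def)
      moreover have "\<gamma> (x mod q) = w" using a l by (simp add: \<gamma>'_def)
      moreover have "x mod q < q" using pq by simp
      moreover have "(x mod q) mod g = y" using a g by (simp add: mod_mod_cancel)
      ultimately show "odd p \<and> (\<exists>z. z < q \<and> z mod g = y \<and> \<gamma> z = w \<and> x = z + q * (p - 1))"
        using x_eq[of x] by metis
    next
      assume "odd p \<and> (\<exists>z. z < q \<and> z mod g = y \<and> \<gamma> z = w \<and> x = z + q * (p - 1))"
      then obtain z where z: "odd p" "z < q" "z mod g = y" "\<gamma> z = w" "x = z + q * (p - 1)" by blast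
      have d: "x div q = p - 1" "x mod q = z" using dm z by auto
      moreover have "x < r" using lt_r[of z "p - 1"] z pq by simp
      moreover have "x mod g = y" using z g d(2) by (metis mod_mod_cancel)
      moreover have "left (p - 1)" using z(1) pq by (simp add: left_def)
      ultimately show "x < r \<and> x mod g = y \<and> \<gamma>' x = 2 * w" using z by (simp add: \<gamma>'_def)
    qed
    show ?thesis unfolding iff by auto
  qed
  have parity: "(\<exists>w. u = 2 * w) \<or> (\<exists>z c. u = 2 * prod_encode (z, c) + 1)" for u :: nat
  proof (cases "even u")
    case False
    then obtain w where "u = 2 * w + 1" by (elim oddE)
    moreover obtain z c where "w = prod_encode (z, c)"
      by (metis prod_decode_inverse surj_pair)
    ultimately show ?thesis by blast
  qed auto
  have inj: "inj_on (\<lambda>z :: nat. z + b) A" for A b by (auto simp: inj_on_def)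
  have "card {x. x < r \<and> \<gamma>' x = u} \<le> 2" for u
  proof -
    consider w where "u = 2 * w" | z c where "u = 2 * prod_encode (z, c) + 1" using parity by blast
    then show ?thesis
    proof cases
      case 1
      then show ?thesis using even_set[of 1 0 w] cardK[of w] by (simp add: card_image[OF inj])
    next
      case 2
      then show ?thesis using odd_set[of 1 0 z c] by (simp add: card_insert_if)
    qed
  qed
  moreover have "(\<Sum>u\<in>\<gamma>' ` {..<r}. \<bar>\<Sum>x | x < r \<and> x mod g = y \<and> \<gamma>' x = u. s' x\<bar>) \<le> 1" if g: "g dvd r" for g y
  proof (cases "g dvd q")
    case False
    \<comment> \<open>The remaining divisor g = r has cosets with at most one point.\<close>
    then have gr: "g = r" using dvd g by (auto simp: r_def)
    have "{x. x < r \<and> x mod g = y} \<subseteq> {y}" by (auto simp: gr)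
    then have "card {x. x < r \<and> x mod g = y} \<le> 1" using card_mono[of "{y}"] by fastforce
    then show ?thesis
      using sum_abs_group_sums_le_card[where r = r and s = s' and \<gamma> = \<gamma>' and g = g and y = y] s' by (smt (verit) of_nat_le_1_iff)
  next
    case True
    define N' where "N' = (\<lambda>u. \<bar>\<Sum>x | x < r \<and> x mod g = y \<and> \<gamma>' x = u. s' x\<bar>)"
    define N where "N = (\<lambda>u. \<bar>\<Sum>x | x < q \<and> x mod g = y \<and> \<gamma> x = u. s x\<bar>)"
    \<comment> \<open>Both members of a pair have the same residue modulo q, hence modulo g, so they
      enter a coset together and cancel.\<close>
    have N'_odd: "N' (2 * prod_encode (z, c) + 1) = 0" for z c
    proof (cases "z < q \<and> z mod g = y \<and> 2 * c + 1 < p")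
      case True
      then have z: "z < q" by simp
      have "s' (z + q * (2 * c)) = 1" "s' (z + q * (2 * c + 1)) = -1"
        unfolding s'_def dm(1)[OF z] using True by (auto simp: left_def)
      moreover have "z + q * (2 * c) \<noteq> z + q * (2 * c + 1)" using pq by simp
      ultimately show ?thesis unfolding N'_def odd_set[OF \<open>g dvd q\<close>] using True by simp
    qed (unfold N'_def odd_set[OF \<open>g dvd q\<close>], auto)
    have N'_even: "N' (2 * w) \<le> N w" for w
    proof (cases "odd p")
      case True
      then have "left (p - 1)" using pq by (simp add: left_def)
      then have "s' (z + q * (p - 1)) = s z" if "z < q" for z
        unfolding s'_def using dm[OF that] by simp
      then have "N' (2 * w) = N w"
        unfolding N'_def N_def even_set[OF \<open>g dvd q\<close>] using True by (simp add: sum.reindex[OF inj])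
      then show ?thesis by simp
    next
      case False
      then show ?thesis unfolding N'_def N_def even_set[OF \<open>g dvd q\<close>] by simp
    qed
    have "(\<Sum>u\<in>\<gamma>' ` {..<r}. N' u) \<le> (\<Sum>u\<in>(*) 2 ` \<gamma> ` {..<q}. N' u)"
    proof (rule sum_le_sum_superset)
      fix u assume u: "u \<in> \<gamma>' ` {..<r} - (*) 2 ` \<gamma> ` {..<q}"
      then obtain x where x: "u = \<gamma>' x" by auto
      have "\<not> left (x div q)"
      proof
        assume "left (x div q)"
        then have "u = 2 * \<gamma> (x mod q)" by (simp add: x \<gamma>'_def)
        then show False using u pq by auto
      qed
      then have "u = 2 * prod_encode (x mod q, x div q div 2) + 1" by (simp add: x \<gamma>'_def)
      then show "N' u = 0" using N'_odd by simp
    qed (auto simp: N'_def)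
    also have "\<dots> = (\<Sum>w\<in>\<gamma> ` {..<q}. N' (2 * w))" by (subst sum.reindex) (auto simp: inj_on_def)
    also have "\<dots> \<le> (\<Sum>w\<in>\<gamma> ` {..<q}. N w)" by (intro sum_mono N'_even)
    also have "\<dots> \<le> 1" unfolding N_def by (rule coset[OF True])
    finally show ?thesis by (simp add: N'_def)
  qed
  ultimately have "balanced_grouping r 2 \<gamma>' s'" using s' unfolding balanced_grouping_def by blast
  then show ?thesis unfolding r_def by blast
qed

lemma balanced_grouping_one: "1 \<le> K \<Longrightarrow> balanced_grouping 1 K (\<lambda>_. 0) (\<lambda>_. 1)"
proof -
  assume K: "1 \<le> K"
  have "card {x :: nat. x < 1 \<and> 0 = u} \<le> K" for u :: nat
    using K by (cases "u = 0") auto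
  moreover have "card {x :: nat. x < 1 \<and> x mod g = y} \<le> 1" for g y
    using card_mono[of "{..<1 :: nat}" "{x. x < 1 \<and> x mod g = y}"] by auto
  then have "(\<Sum>u\<in>(\<lambda>_. 0 :: nat) ` {..<1 :: nat}. \<bar>\<Sum>x | x < 1 \<and> x mod g = y \<and> 0 = u. 1 :: int\<bar>) \<le> 1" for g y :: nat
    using sum_abs_group_sums_le_card[where r = 1 and s = "\<lambda>_. 1" and \<gamma> = "\<lambda>_. 0 :: nat" and g = g and y = y]
    by (metis (mono_tags, lifting) insertI1 of_nat_1 of_nat_mono order_trans)
  ultimately show ?thesis unfolding balanced_grouping_def by blast
qed

text \<open>Each proper divisor of p ^ (a + 1) divides p ^ a, which is what
  \<open>balanced_grouping_mult\<close> asks for; the group size stays 2 throughout the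
  induction.\<close>

lemma balanced_grouping_prime_power:
  assumes "prime p"
  shows "\<exists>\<gamma> s. balanced_grouping (p ^ a) 2 \<gamma> s"
proof (induction a)
  case 0
  then show ?case using balanced_grouping_one[of 2] by auto
next
  case (Suc a)
  then obtain \<gamma> s where "balanced_grouping (p ^ a) 2 \<gamma> s" by blast
  moreover have "g dvd p ^ a \<or> g = p ^ a * p" if "g dvd p ^ a * p" for g
  proof -
    have "g dvd p ^ Suc a" using that by (simp add: mult.commute)
    then obtain i where "i \<le> Suc a" "g = p ^ i" using divides_primepow_nat[OF assms] by blast
    then show ?thesis by (cases "i = Suc a") (auto simp: le_imp_power_dvd)
  qed
  ultimately have "\<exists>\<gamma>' s'. balanced_grouping (p ^ a * p) 2 \<gamma>' s'"
    using assms by (intro balanced_grouping_mult) (auto simp: prime_gt_0_nat)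
  then show ?case by (simp add: mult.commute)
qed

section \<open>Products of groupings by the Chinese remainder theorem\<close>

lemma bij_betw_mod_pair:
  fixes r1 r2 :: nat
  assumes "coprime r1 r2" "0 < r1" "0 < r2"
  shows "bij_betw (\<lambda>x. (x mod r1, x mod r2)) {..<r1 * r2} ({..<r1} \<times> {..<r2})"
proof -
  have inj: "inj_on (\<lambda>x. (x mod r1, x mod r2)) {..<r1 * r2}"
  proof (rule inj_onI)
    fix x y assume xy: "x \<in> {..<r1 * r2}" "y \<in> {..<r1 * r2}" "(x mod r1, x mod r2) = (y mod r1, y mod r2)"
    then have "[x = y] (mod r1)" "[x = y] (mod r2)" by (auto simp: cong_def)
    then have "[x = y] (mod r1 * r2)" using assms(1) by (simp add: coprime_cong_mult_nat)
    then show "x = y" using xy(1,2) by (simp add: cong_def)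
  qed
  have "(\<lambda>x. (x mod r1, x mod r2)) ` {..<r1 * r2} = {..<r1} \<times> {..<r2}"
  proof (rule card_subset_eq)
    show "(\<lambda>x. (x mod r1, x mod r2)) ` {..<r1 * r2} \<subseteq> {..<r1} \<times> {..<r2}" using assms by auto
    show "card ((\<lambda>x. (x mod r1, x mod r2)) ` {..<r1 * r2}) = card ({..<r1} \<times> {..<r2})"
      using card_image[OF inj] by (simp add: card_cartesian_product)
  qed simp
  with inj show ?thesis by (simp add: bij_betw_def)
qed

lemma bij_betw_Collect_mod_pair:
  fixes r1 r2 :: nat
  assumes "coprime r1 r2" "0 < r1" "0 < r2"
    and P: "\<And>x. x < r1 * r2 \<Longrightarrow> P x \<longleftrightarrow> Q (x mod r1) \<and> R (x mod r2)"
  shows "bij_betw (\<lambda>x. (x mod r1, x mod r2)) {x. x < r1 * r2 \<and> P x} ({z. z < r1 \<and> Q z} \<times> {z. z < r2 \<and> R z})"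
proof -
  let ?f = "\<lambda>x. (x mod r1, x mod r2)"
  have b: "bij_betw ?f {..<r1 * r2} ({..<r1} \<times> {..<r2})" by (rule bij_betw_mod_pair[OF assms(1-3)])
  have "inj_on ?f {x. x < r1 * r2 \<and> P x}"
    using b by (auto simp: bij_betw_def intro: inj_on_subset)
  moreover have "?f ` {x. x < r1 * r2 \<and> P x} = {z. z < r1 \<and> Q z} \<times> {z. z < r2 \<and> R z}"
  proof (intro equalityI subsetI)
    fix w assume "w \<in> ?f ` {x. x < r1 * r2 \<and> P x}"
    then obtain x where "x < r1 * r2" "P x" "w = ?f x" by blast
    then show "w \<in> {z. z < r1 \<and> Q z} \<times> {z. z < r2 \<and> R z}" using P assms by auto
  next
    fix w assume w: "w \<in> {z. z < r1 \<and> Q z} \<times> {z. z < r2 \<and> R z}"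
    then have "w \<in> ?f ` {..<r1 * r2}" using b by (auto simp: bij_betw_def)
    then obtain x where x: "x < r1 * r2" "w = ?f x" by blast
    then have "P x" using P[of x] w by auto
    with x show "w \<in> ?f ` {x. x < r1 * r2 \<and> P x}" by blast
  qed
  ultimately show ?thesis by (simp add: bij_betw_def)
qed

text \<open>Under the Chinese remainder bijection groups are products of groups. A divisor of r1 r2
  splits into divisors of r1 and r2, so cosets are products of cosets too. The sum of absolute
  values therefore factors into two sums that are each at most 1.\<close>

lemma balanced_grouping_coprime_mult:
  assumes bal1: "balanced_grouping r1 K1 \<gamma>1 s1" and bal2: "balanced_grouping r2 K2 \<gamma>2 s2"
    and r: "coprime r1 r2" "0 < r1" "0 < r2"
  shows "balanced_grouping (r1 * r2) (K1 * K2) (\<lambda>x. prod_encode (\<gamma>1 (x mod r1), \<gamma>2 (x mod r2)))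
    (\<lambda>x. s1 (x mod r1) * s2 (x mod r2))"
proof -
  define \<gamma> where "\<gamma> = (\<lambda>x. prod_encode (\<gamma>1 (x mod r1), \<gamma>2 (x mod r2)))"
  define s where "s = (\<lambda>x. s1 (x mod r1) * s2 (x mod r2))"
  have s1: "\<And>x. x < r1 \<Longrightarrow> s1 x \<in> {1, -1}"
    and K1: "\<And>u. card {x. x < r1 \<and> \<gamma>1 x = u} \<le> K1"
    and c1: "\<And>g y. g dvd r1 \<Longrightarrow> (\<Sum>u\<in>\<gamma>1 ` {..<r1}. \<bar>\<Sum>x | x < r1 \<and> x mod g = y \<and> \<gamma>1 x = u. s1 x\<bar>) \<le> 1"
    using bal1 unfolding balanced_grouping_def by blast+
  have s2: "\<And>x. x < r2 \<Longrightarrow> s2 x \<in> {1, -1}"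
    and K2: "\<And>u. card {x. x < r2 \<and> \<gamma>2 x = u} \<le> K2"
    and c2: "\<And>g y. g dvd r2 \<Longrightarrow> (\<Sum>u\<in>\<gamma>2 ` {..<r2}. \<bar>\<Sum>x | x < r2 \<and> x mod g = y \<and> \<gamma>2 x = u. s2 x\<bar>) \<le> 1"
    using bal2 unfolding balanced_grouping_def by blast+
  have "s x \<in> {1, -1}" for x
    using s1[of "x mod r1"] s2[of "x mod r2"] r by (auto simp: s_def)
  moreover have "card {x. x < r1 * r2 \<and> \<gamma> x = u} \<le> K1 * K2" for u
  proof -
    obtain u1 u2 where u: "u = prod_encode (u1, u2)" by (metis prod_decode_inverse surj_pair)
    have "card {x. x < r1 * r2 \<and> \<gamma> x = u} = card ({z. z < r1 \<and> \<gamma>1 z = u1} \<times> {z. z < r2 \<and> \<gamma>2 z = u2})"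
      by (rule bij_betw_same_card[OF bij_betw_Collect_mod_pair[OF r]]) (simp add: \<gamma>_def u)
    also have "\<dots> \<le> K1 * K2" unfolding card_cartesian_product by (intro mult_mono K1 K2) auto
    finally show ?thesis .
  qed
  moreover have "(\<Sum>u\<in>\<gamma> ` {..<r1 * r2}. \<bar>\<Sum>x | x < r1 * r2 \<and> x mod g = y \<and> \<gamma> x = u. s x\<bar>) \<le> 1"
    if g: "g dvd r1 * r2" for g y
  proof (cases "y < g")
    case False
    have "0 < r1 * r2" using r by simp
    then have "0 < g" using g by (metis dvd_0_left gr0I less_irrefl)
    then have e: "{x. x < r1 * r2 \<and> x mod g = y \<and> \<gamma> x = u} = {}" for u
      using False by auto
    show ?thesis unfolding e by simp
  next
    case True
    obtain g1 g2 where g12: "g = g1 * g2" "g1 dvd r1" "g2 dvd r2" using division_decomp[OF g] by blast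
    have cop: "coprime g1 g2" using r(1) g12 by (metis coprime_divisors)
    define N1 where "N1 = (\<lambda>u. \<Sum>x | x < r1 \<and> x mod g1 = y mod g1 \<and> \<gamma>1 x = u. s1 x)"
    define N2 where "N2 = (\<lambda>u. \<Sum>x | x < r2 \<and> x mod g2 = y mod g2 \<and> \<gamma>2 x = u. s2 x)"
    have mod_iff: "x mod g = y \<longleftrightarrow> (x mod r1) mod g1 = y mod g1 \<and> (x mod r2) mod g2 = y mod g2" for x
    proof -
      have "x mod g = y \<longleftrightarrow> [x = y] (mod g1 * g2)" using True by (simp add: cong_def g12)
      also have "\<dots> \<longleftrightarrow> [x = y] (mod g1) \<and> [x = y] (mod g2)"
        using cop coprime_cong_mult_nat cong_modulus_mult_nat by (metis mult.commute)
      finally show ?thesis using g12 by (simp add: cong_def mod_mod_cancel)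
    qed
    have N: "(\<Sum>x | x < r1 * r2 \<and> x mod g = y \<and> \<gamma> x = prod_encode (u1, u2). s x) = N1 u1 * N2 u2" for u1 u2
    proof -
      have "N1 u1 * N2 u2 = (\<Sum>(z1, z2)\<in>{z. z < r1 \<and> z mod g1 = y mod g1 \<and> \<gamma>1 z = u1}
            \<times> {z. z < r2 \<and> z mod g2 = y mod g2 \<and> \<gamma>2 z = u2}. s1 z1 * s2 z2)"
        by (simp add: N1_def N2_def sum_product sum.cartesian_product)
      also have "\<dots> = (\<Sum>x | x < r1 * r2 \<and> x mod g = y \<and> \<gamma> x = prod_encode (u1, u2).
            (\<lambda>(z1, z2). s1 z1 * s2 z2) (x mod r1, x mod r2))"
        by (rule sum.reindex_bij_betw[symmetric, OF bij_betw_Collect_mod_pair[OF r]])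
          (auto simp: mod_iff \<gamma>_def)
      finally show ?thesis by (simp add: s_def)
    qed
    let ?f = "\<lambda>u. \<bar>\<Sum>x | x < r1 * r2 \<and> x mod g = y \<and> \<gamma> x = u. s x\<bar>"
    have "(\<Sum>u\<in>\<gamma> ` {..<r1 * r2}. ?f u) \<le> (\<Sum>u\<in>prod_encode ` (\<gamma>1 ` {..<r1} \<times> \<gamma>2 ` {..<r2}). ?f u)"
      using r by (intro sum_mono2) (auto simp: \<gamma>_def)
    also have "\<dots> = (\<Sum>(u1, u2)\<in>\<gamma>1 ` {..<r1} \<times> \<gamma>2 ` {..<r2}. \<bar>N1 u1\<bar> * \<bar>N2 u2\<bar>)"
      by (subst sum.reindex) (auto simp: N abs_mult inj_on_def intro!: sum.cong)
    also have "\<dots> = (\<Sum>u\<in>\<gamma>1 ` {..<r1}. \<bar>N1 u\<bar>) * (\<Sum>u\<in>\<gamma>2 ` {..<r2}. \<bar>N2 u\<bar>)"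
      by (simp add: sum_product sum.cartesian_product)
    also have "\<dots> \<le> 1 * 1"
      unfolding N1_def N2_def by (intro mult_mono c1 c2 g12 sum_nonneg) auto
    finally show ?thesis by simp
  qed
  ultimately show ?thesis unfolding balanced_grouping_def \<gamma>_def s_def by blast
qed

text \<open>Split off the full power of one prime at a time; each prime doubles the permitted group
  size.\<close>

lemma balanced_grouping_exists:
  assumes "0 < r"
  shows "\<exists>\<gamma> s. balanced_grouping r (2 ^ omega r) \<gamma> s"
  using assms
proof (induction r rule: less_induct)
  case (less r)
  show ?case
  proof (cases "r = 1")
    case True
    then show ?thesis using balanced_grouping_one[of "2 ^ omega r"] by auto
  next
    case False
    then obtain p where p: "prime p" "p dvd r" using prime_factor_nat by blast
    have np: "\<not> is_unit p" using p(1) by auto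
    obtain r' where r': "r = p ^ multiplicity p r * r'" "\<not> p dvd r'"
      using multiplicity_decompose'[of r p] less.prems np by auto
    define a where "a = multiplicity p r"
    have a: "0 < a" using p less.prems by (simp add: a_def prime_multiplicity_gt_zero_iff)
    have r'0: "0 < r'" using r'(2) by (cases "r' = 0") auto
    have pa: "2 \<le> p ^ a" using p(1) a by (metis prime_ge_2_nat self_le_power order.trans prime_ge_1_nat)
    have "r' < p ^ a * r'" using pa r'0 by simp
    then have "r' < r" using r' by (simp add: a_def)
    then obtain \<gamma>2 s2 where 2: "balanced_grouping r' (2 ^ omega r') \<gamma>2 s2" using less.IH r'0 by blast
    obtain \<gamma>1 s1 where 1: "balanced_grouping (p ^ a) 2 \<gamma>1 s1" using balanced_grouping_prime_power[OF p(1)] by blast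
    have "coprime (p ^ a) r'" using prime_imp_coprime[OF p(1) r'(2)] by (simp add: coprime_power_left_iff)
    moreover have "0 < p ^ a" using pa by linarith
    ultimately have "\<exists>\<gamma> s. balanced_grouping (p ^ a * r') (2 * 2 ^ omega r') \<gamma> s"
      using balanced_grouping_coprime_mult[OF 1 2 _ _ r'0] by blast
    moreover have "omega r = Suc (omega r')"
    proof -
      have "prime_factors (p ^ a) = {p}"
        using p(1) a by (simp add: prime_factorization_prime_power)
      moreover have "prime_factors (p ^ a * r') = prime_factors (p ^ a) \<union> prime_factors r'"
        using prime_gt_0_nat[OF p(1)] r'0 by (intro prime_factors_product) auto
      ultimately have "prime_factors r = insert p (prime_factors r')"
        using r'(1) by (simp add: a_def)
      moreover have "p \<notin> prime_factors r'" using r'(2) by (auto dest: in_prime_factors_imp_dvd)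
      ultimately show ?thesis by (simp add: omega_def)
    qed
    ultimately show ?thesis using r'(1) by (simp add: a_def)
  qed
qed

section \<open>Arithmetic progressions modulo n\<close>

text \<open>The order of d in Z_n is n / gcd n d: divide the congruence by the gcd and cancel the
  cofactor of d, which is coprime to the quotient. It yields both the injectivity of progressions
  and their periodicity.\<close>

lemma ap_mod_eq_iff:
  fixes n a d k k' :: nat
  assumes "0 < n"
  shows "(a + k * d) mod n = (a + k' * d) mod n \<longleftrightarrow> k mod (n div gcd n d) = k' mod (n div gcd n d)"
proof -
  define g where "g = gcd n d"
  have g: "0 < g" using assms by (simp add: g_def)
  obtain p d' where p: "n = g * p" "d = g * d'" unfolding g_def by (meson dvdE gcd_dvd1 gcd_dvd2)
  have cop: "coprime p d'"
  proof -
    have "g * gcd p d' = gcd (g * p) (g * d')" by (rule gcd_mult_distrib_nat)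
    also have "\<dots> = g" unfolding p[symmetric] by (rule g_def[symmetric])
    finally have "gcd p d' = 1" using g by simp
    then show ?thesis by (simp add: coprime_iff_gcd_eq_1)
  qed
  have "(a + k * d) mod n = (a + k' * d) mod n \<longleftrightarrow> [a + k * d = a + k' * d] (mod n)" by (simp add: cong_def)
  also have "\<dots> \<longleftrightarrow> [k * d = k' * d] (mod n)" by (rule cong_add_lcancel_nat)
  also have "\<dots> \<longleftrightarrow> int n dvd int (k * d) - int (k' * d)"
    by (simp only: cong_int_iff[symmetric] cong_iff_dvd_diff)
  also have "int (k * d) - int (k' * d) = int g * ((int k - int k') * int d')"
    by (simp add: p algebra_simps)
  also have "int n = int g * int p" by (simp add: p)
  also have "int g * int p dvd int g * ((int k - int k') * int d') \<longleftrightarrow> int p dvd (int k - int k') * int d'"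
    using g by simp
  also have "\<dots> \<longleftrightarrow> int p dvd int k - int k'"
    using cop by (simp add: coprime_dvd_mult_left_iff)
  also have "\<dots> \<longleftrightarrow> [k = k'] (mod p)" by (simp only: cong_int_iff[symmetric] cong_iff_dvd_diff)
  also have "p = n div gcd n d" using g p(1) by (metis g_def nonzero_mult_div_cancel_left less_numeral_extra(3))
  finally show ?thesis by (simp add: cong_def)
qed

lemma inj_on_ap_mod:
  fixes n a d :: nat
  assumes "0 < n" "l \<le> n div gcd n d"
  shows "inj_on (\<lambda>k. (a + k * d) mod n) {..<l}"
  using assms by (auto simp: inj_on_def ap_mod_eq_iff)

text \<open>The progression stays in one residue class modulo g, and both sets have n / g
  elements.\<close>

lemma ap_mod_image_eq_coset:
  fixes n a d :: nat
  assumes n: "0 < n" and g: "g = gcd n d"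
  shows "(\<lambda>k. (a + k * d) mod n) ` {..<n div g} = {x. x < n \<and> x mod g = a mod g}"
proof (rule card_subset_eq)
  have gn: "g dvd n" "g dvd d" "0 < g" using n by (auto simp: g)
  show "(\<lambda>k. (a + k * d) mod n) ` {..<n div g} \<subseteq> {x. x < n \<and> x mod g = a mod g}"
  proof -
    have "(a + k * d) mod g = a mod g" for k
      using gn(2) by (metis dvd_mult mod_add_right_eq dvd_imp_mod_0 add.right_neutral)
    then show ?thesis using n gn by (auto simp: mod_mod_cancel)
  qed
  have "{x. x < n \<and> x mod g = a mod g} = (\<lambda>k. a mod g + g * k) ` {..<n div g}"
  proof (intro equalityI subsetI)
    fix x assume x: "x \<in> {x. x < n \<and> x mod g = a mod g}"
    then have "x = a mod g + g * (x div g)" by (metis (mono_tags) mem_Collect_eq mod_mult_div_eq)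
    moreover have "x div g < n div g" using x gn by (simp add: div_less_iff_less_mult)
    ultimately show "x \<in> (\<lambda>k. a mod g + g * k) ` {..<n div g}" by blast
  next
    fix x assume "x \<in> (\<lambda>k. a mod g + g * k) ` {..<n div g}"
    then obtain k where k: "x = a mod g + g * k" "k < n div g" by blast
    have "a mod g < g" using gn by simp
    then have "x < g * (k + 1)" using k by simp
    also have "\<dots> \<le> g * (n div g)" using k by (intro mult_left_mono) auto
    also have "\<dots> = n" using gn by simp
    finally show "x \<in> {x. x < n \<and> x mod g = a mod g}" using k by simp
  qed
  moreover have "inj_on (\<lambda>k. a mod g + g * k) {..<n div g}" using gn by (auto simp: inj_on_def)
  ultimately have "card {x. x < n \<and> x mod g = a mod g} = n div g" by (simp add: card_image)
  moreover have "card ((\<lambda>k. (a + k * d) mod n) ` {..<n div g}) = n div g"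
    using card_image[OF inj_on_ap_mod[OF n order.refl, of a d]] by (simp add: g)
  ultimately show "card ((\<lambda>k. (a + k * d) mod n) ` {..<n div g}) = card {x. x < n \<and> x mod g = a mod g}" by simp
qed simp

lemma sum_periodic:
  fixes F :: "nat \<Rightarrow> 'a :: comm_semiring_1"
  assumes "\<And>k. F (k + p) = F k"
  shows "(\<Sum>k<q * p + t. F k) = of_nat q * (\<Sum>k<p. F k) + (\<Sum>k<t. F k)"
proof (induction q)
  case (Suc q)
  have "(\<Sum>k<Suc q * p + t. F k) = (\<Sum>k<p. F k) + (\<Sum>k=p..<p + (q * p + t). F k)"
    unfolding lessThan_atLeast0 by (subst sum.atLeastLessThan_concat) (auto simp: add.assoc)
  also have "(\<Sum>k=p..<p + (q * p + t). F k) = (\<Sum>k<q * p + t. F k)"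
    using assms sum.shift_bounds_nat_ivl[of F 0 p "q * p + t"] by (simp add: lessThan_atLeast0 add.commute)
  finally show ?case using Suc by (simp add: algebra_simps)
qed simp

section \<open>Upper bound\<close>

text \<open>The ordering in the hypothesis runs through the cosets c = 0, 1, ... of the subgroup
  generated by d, each in the order c, c + d, c + 2d, and so on. A start of one coset is a
  difference of two prefixes, giving 2 B. The given progression is \<open>G (k0 + l) - G k0\<close>;
  it wraps around its coset at most once, so the two terms cost 4 B and 2 B.\<close>

lemma abs_ap_sum_le_of_prefix_bound:
  fixes \<psi> :: "nat \<Rightarrow> int" and r d a l :: nat and B :: real
  assumes r: "0 < r" and p: "p = r div gcd r d" and l: "l \<le> p"
    and B: "\<And>t. t \<le> r \<Longrightarrow> \<bar>\<Sum>i<t. real_of_int (\<psi> ((i div p + (i mod p) * d) mod r))\<bar> \<le> B"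
  shows "\<bar>\<Sum>k<l. real_of_int (\<psi> ((a + k * d) mod r))\<bar> \<le> 6 * B"
proof -
  define g where "g = gcd r d"
  define c where "c = a mod g"
  define G where "G = (\<lambda>t. \<Sum>k<t. real_of_int (\<psi> ((c + k * d) mod r)))"
  have g: "0 < g" "g dvd r" using r by (auto simp: g_def)
  have rpg: "r = g * p" using g by (simp add: p g_def[symmetric])
  have p0: "0 < p" using r rpg by (cases "p = 0") auto
  have c: "c < g" using g by (simp add: c_def)
  have G2B: "\<bar>G t\<bar> \<le> 2 * B" if "t \<le> p" for t
  proof -
    have "c * p + t \<le> (c + 1) * p" using that by simp
    also have "\<dots> \<le> r" using c unfolding rpg by (intro mult_right_mono) auto
    finally have le: "c * p + t \<le> r" .
    define h where "h = (\<lambda>i. real_of_int (\<psi> ((i div p + (i mod p) * d) mod r)))"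
    have "(\<Sum>i<c * p + t. h i) = (\<Sum>i<c * p. h i) + (\<Sum>i=c * p..<c * p + t. h i)"
      unfolding lessThan_atLeast0 by (intro sum.atLeastLessThan_concat[symmetric]) auto
    also have "(\<Sum>i=c * p..<c * p + t. h i) = (\<Sum>k<t. h (c * p + k))"
      using sum.shift_bounds_nat_ivl[of h 0 "c * p" t] by (simp add: lessThan_atLeast0 add.commute)
    also have "\<dots> = G t"
      unfolding G_def h_def using that p0 by (intro sum.cong) auto
    finally have "G t = (\<Sum>i<c * p + t. h i) - (\<Sum>i<c * p. h i)" by simp
    moreover have "\<bar>\<Sum>i<c * p + t. h i\<bar> \<le> B" "\<bar>\<Sum>i<c * p. h i\<bar> \<le> B"
      unfolding h_def using le by (auto intro!: B)
    ultimately show ?thesis by linarith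
  qed
  have "a mod r \<in> {x. x < r \<and> x mod g = c mod g}" using r g by (simp add: c_def mod_mod_cancel)
  then have "a mod r \<in> (\<lambda>k. (c + k * d) mod r) ` {..<r div g}"
    using ap_mod_image_eq_coset[OF r g_def, of c] by simp
  then obtain k0 where k0: "a mod r = (c + k0 * d) mod r" "k0 < p" by (auto simp: p g_def)
  have shift: "(a + k * d) mod r = (c + (k0 + k) * d) mod r" for k
  proof -
    have "(a + k * d) mod r = (a mod r + k * d) mod r" by (simp add: mod_add_left_eq)
    also have "\<dots> = (c + k0 * d + k * d) mod r" unfolding k0(1) by (rule mod_add_left_eq)
    finally show ?thesis by (simp add: algebra_simps)
  qed
  have "(\<Sum>k<k0 + l. real_of_int (\<psi> ((c + k * d) mod r))) = G k0 + (\<Sum>k=k0..<k0 + l. real_of_int (\<psi> ((c + k * d) mod r)))"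
    unfolding G_def lessThan_atLeast0 by (intro sum.atLeastLessThan_concat[symmetric]) auto
  also have "(\<Sum>k=k0..<k0 + l. real_of_int (\<psi> ((c + k * d) mod r))) = (\<Sum>k<l. real_of_int (\<psi> ((a + k * d) mod r)))"
    using sum.shift_bounds_nat_ivl[of "\<lambda>k. real_of_int (\<psi> ((c + k * d) mod r))" 0 k0 l]
    by (simp add: lessThan_atLeast0 add.commute shift)
  finally have main: "(\<Sum>k<l. real_of_int (\<psi> ((a + k * d) mod r))) = G (k0 + l) - G k0" by (simp add: G_def)
  have "\<bar>G (k0 + l)\<bar> \<le> 4 * B"
  proof (cases "k0 + l \<le> p")
    case True
    from G2B[OF this] G2B[of 0] show ?thesis by (simp add: G_def)
  next
    case False
    have per: "(c + (k + p) * d) mod r = (c + k * d) mod r" for k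
      using r by (subst ap_mod_eq_iff) (simp_all add: p)
    have "G (1 * p + (k0 + l - p)) = of_nat 1 * G p + G (k0 + l - p)"
      unfolding G_def by (rule sum_periodic) (simp only: per)
    then have "G (k0 + l) = G p + G (k0 + l - p)" using False by simp
    moreover have "k0 + l - p \<le> p" using k0 l by simp
    ultimately show ?thesis using G2B[of p] G2B[of "k0 + l - p"] by simp
  qed
  with main G2B[of k0] k0 show ?thesis by simp
qed

lemma balanced_coloring_exists:
  assumes r: "0 < r"
  shows "\<exists>\<psi> :: nat \<Rightarrow> int. (\<forall>x<r. \<psi> x \<in> {1, -1})
    \<and> (\<forall>g y. g dvd r \<longrightarrow> \<bar>\<Sum>x | x < r \<and> x mod g = y. \<psi> x\<bar> \<le> 1)
    \<and> (\<forall>a d l. l \<le> r div gcd r d \<longrightarrow>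
        \<bar>\<Sum>k<l. real_of_int (\<psi> ((a + k * d) mod r))\<bar> \<le> 6 * (prefix_const * 2 ^ omega r * sqrt r))"
proof -
  obtain \<gamma> s where bal: "balanced_grouping r (2 ^ omega r) \<gamma> s"
    using balanced_grouping_exists[OF r] by blast
  have s: "\<And>x. x < r \<Longrightarrow> s x \<in> {1, -1}"
    and cardK: "\<And>u. card {x. x < r \<and> \<gamma> x = u} \<le> 2 ^ omega r"
    and coset: "\<And>g y. g dvd r \<Longrightarrow> (\<Sum>u\<in>\<gamma> ` {..<r}. \<bar>\<Sum>x | x < r \<and> x mod g = y \<and> \<gamma> x = u. s x\<bar>) \<le> 1"
    using bal unfolding balanced_grouping_def by blast+
  define f where "f = (\<lambda>d i. (i div (r div gcd r d) + (i mod (r div gcd r d)) * d) mod r)"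
  \<comment> \<open>The residue of \<open>f d i\<close> modulo gcd r d recovers the coset i div p;
    then \<open>ap_mod_eq_iff\<close> recovers the position i mod p.\<close>
  have inj_f: "inj_on (f d) {..<r}" for d
  proof (rule inj_onI)
    fix i j assume ij: "i \<in> {..<r}" "j \<in> {..<r}" "f d i = f d j"
    define g where "g = gcd r d"
    define p where "p = r div g"
    have g: "0 < g" "g dvd r" "g dvd d" using r by (auto simp: g_def)
    have rpg: "r = g * p" using g by (simp add: p_def)
    have div_lt: "i div p < g" if "i < r" for i
      using that rpg by (simp add: div_less_iff_less_mult less_mult_imp_div_less)
    have fmod: "f d i mod g = i div p" if "i < r" for i
    proof -
      have "f d i mod g = (i div p + (i mod p) * d) mod g"
        unfolding f_def g_def[symmetric] p_def[symmetric] using g by (simp add: mod_mod_cancel)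
      also have "\<dots> = (i div p) mod g"
        using g(3) by (metis dvd_mult mod_add_right_eq dvd_imp_mod_0 add.right_neutral)
      finally show ?thesis using div_lt[OF that] by simp
    qed
    then have c: "i div p = j div p" using ij by (metis lessThan_iff)
    then have "(i div p + (i mod p) * d) mod r = (i div p + (j mod p) * d) mod r"
      using ij(3) unfolding f_def g_def[symmetric] p_def[symmetric] by simp
    then have "i mod p mod p = j mod p mod p"
      using ap_mod_eq_iff[OF r, of "i div p" "i mod p" d "j mod p"] unfolding g_def[symmetric] p_def[symmetric] by simp
    then show "i = j" using c by (metis div_mod_decomp mod_mod_trivial)
  qed
  have f_lt: "f d i < r" for d i using r by (simp add: f_def)
  define L where "L = (\<lambda>d. map (f d) [0..<r])"
  interpret grouped_lists "{..<r}" L r "2 ^ omega r" \<gamma> "\<lambda>x. real_of_int (s x)"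
  proof
    show "distinct (L d)" for d using inj_f[of d] by (simp add: L_def distinct_map lessThan_atLeast0)
    show "set (L d) \<subseteq> {..<r}" for d using f_lt by (auto simp: L_def)
    show "\<bar>real_of_int (s z)\<bar> \<le> 1" if "z \<in> {..<r}" for z using s[of z] that by auto
    show "card {z \<in> {..<r}. \<gamma> z = u} \<le> 2 ^ omega r" for u using cardK[of u] by simp
  qed auto
  obtain \<epsilon> where \<epsilon>: "\<And>u. \<epsilon> u \<in> {-1, 1 :: real}"
    "\<And>d t. d < r \<Longrightarrow> \<bar>\<Sum>z\<leftarrow>take t (L d). real_of_int (s z) * \<epsilon> (\<gamma> z)\<bar> \<le> prefix_const * (2 ^ omega r) * sqrt r"
    using prefix_coloring by auto
  define e where "e = (\<lambda>u. if \<epsilon> u = 1 then 1 else -1 :: int)"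
  have e: "real_of_int (e u) = \<epsilon> u" "\<bar>e u\<bar> = 1" for u using \<epsilon>(1)[of u] by (auto simp: e_def)
  define \<psi> where "\<psi> = (\<lambda>x. s x * e (\<gamma> x))"
  have "\<psi> x \<in> {1, -1}" if "x < r" for x using s[OF that] by (auto simp: \<psi>_def e_def)
  moreover have "\<bar>\<Sum>x | x < r \<and> x mod g = y. \<psi> x\<bar> \<le> 1" if g: "g dvd r" for g y
  proof -
    have "(\<Sum>x | x < r \<and> x mod g = y. \<psi> x)
        = (\<Sum>u\<in>\<gamma> ` {..<r}. \<Sum>x | x \<in> {x. x < r \<and> x mod g = y} \<and> \<gamma> x = u. \<psi> x)"
      using sum.group[of "{x. x < r \<and> x mod g = y}" "\<gamma> ` {..<r}" \<gamma> \<psi>] by (simp add: image_subset_iff)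
    also have "\<dots> = (\<Sum>u\<in>\<gamma> ` {..<r}. e u * (\<Sum>x | x < r \<and> x mod g = y \<and> \<gamma> x = u. s x))"
    proof (rule sum.cong)
      fix u
      have "(\<Sum>x | x \<in> {x. x < r \<and> x mod g = y} \<and> \<gamma> x = u. \<psi> x)
          = (\<Sum>x | x < r \<and> x mod g = y \<and> \<gamma> x = u. e u * s x)"
        by (rule sum.cong) (auto simp: \<psi>_def)
      then show "(\<Sum>x | x \<in> {x. x < r \<and> x mod g = y} \<and> \<gamma> x = u. \<psi> x)
          = e u * (\<Sum>x | x < r \<and> x mod g = y \<and> \<gamma> x = u. s x)"
        by (simp only: sum_distrib_left)
    qed simp
    finally have "\<bar>\<Sum>x | x < r \<and> x mod g = y. \<psi> x\<bar>
        = \<bar>\<Sum>u\<in>\<gamma> ` {..<r}. e u * (\<Sum>x | x < r \<and> x mod g = y \<and> \<gamma> x = u. s x)\<bar>"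
      by (rule arg_cong)
    also have "\<dots> \<le> (\<Sum>u\<in>\<gamma> ` {..<r}. \<bar>e u * (\<Sum>x | x < r \<and> x mod g = y \<and> \<gamma> x = u. s x)\<bar>)"
      by (rule sum_abs)
    also have "\<dots> = (\<Sum>u\<in>\<gamma> ` {..<r}. \<bar>\<Sum>x | x < r \<and> x mod g = y \<and> \<gamma> x = u. s x\<bar>)"
      by (simp only: abs_mult e(2) mult_1)
    also have "\<dots> \<le> 1" by (rule coset[OF g])
    finally show ?thesis .
  qed
  moreover have "\<bar>\<Sum>k<l. real_of_int (\<psi> ((a + k * d) mod r))\<bar> \<le> 6 * (prefix_const * 2 ^ omega r * sqrt r)"
    if l: "l \<le> r div gcd r d" for a d l
  proof -
    \<comment> \<open>Only differences below r have a list, so d is reduced first; this changes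
      neither the gcd with r nor the progression.\<close>
    define d' where "d' = d mod r"
    have d': "d' < r" "gcd r d' = gcd r d" using r by (auto simp: d'_def gcd_mod_right)
    have "\<bar>\<Sum>k<l. real_of_int (\<psi> ((a + k * d') mod r))\<bar> \<le> 6 * (prefix_const * 2 ^ omega r * sqrt r)"
    proof (rule abs_ap_sum_le_of_prefix_bound[OF r refl])
      show "l \<le> r div gcd r d'" using l d' by simp
      fix t assume t: "t \<le> r"
      have "take t (L d') = map (f d') [0..<t]" using t by (simp add: L_def take_map take_upt)
      then have "(\<Sum>z\<leftarrow>take t (L d'). real_of_int (s z) * \<epsilon> (\<gamma> z)) = (\<Sum>i<t. real_of_int (\<psi> (f d' i)))"
        by (simp add: comp_def \<psi>_def e interv_sum_list_conv_sum_set_nat lessThan_atLeast0)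
      then show "\<bar>\<Sum>i<t. real_of_int (\<psi> ((i div (r div gcd r d') + i mod (r div gcd r d') * d') mod r))\<bar>
          \<le> prefix_const * 2 ^ omega r * sqrt r"
        using \<epsilon>(2)[OF d'(1), of t] by (simp add: f_def)
    qed
    moreover have "(a + k * d') mod r = (a + k * d) mod r" for k
      unfolding d'_def by (metis mod_add_right_eq mod_mult_right_eq)
    ultimately show ?thesis by simp
  qed
  ultimately show ?thesis by blast
qed

section \<open>The discrepancy as a minimum over colourings of maxima over progressions\<close>

lemma finite_arith_progs: "finite (arith_progs n)"
proof (rule finite_subset)
  show "arith_progs n \<subseteq> Pow {..<n}" unfolding arith_progs_def by auto
qed simp

lemma sum_arith_prog:
  fixes \<chi> :: "nat \<Rightarrow> int"
  assumes "0 < n" "l \<le> n div gcd n d"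
  shows "(\<Sum>x\<in>{(a + k * d) mod n | k. k < l}. \<chi> x) = (\<Sum>k<l. \<chi> ((a + k * d) mod n))"
proof -
  have "{(a + k * d) mod n | k. k < l} = (\<lambda>k. (a + k * d) mod n) ` {..<l}" by auto
  then show ?thesis by (simp add: sum.reindex[OF inj_on_ap_mod[OF assms]])
qed

lemma Max_AP_sums_bounds:
  fixes \<chi> :: "nat \<Rightarrow> int"
  assumes "0 < n" "\<forall>x<n. \<chi> x \<in> {1, -1}"
  shows "Max {\<bar>\<Sum>x\<in>A. \<chi> x\<bar> | A. A \<in> arith_progs n} \<in> {0..int n}"
proof -
  have fin: "finite {\<bar>\<Sum>x\<in>A. \<chi> x\<bar> | A. A \<in> arith_progs n}"
    using finite_arith_progs by simp
  have "{(0 + k * 0) mod n | k. k < 0} \<in> arith_progs n"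
    unfolding arith_progs_def using assms(1) by blast
  then have ne: "{\<bar>\<Sum>x\<in>A. \<chi> x\<bar> | A. A \<in> arith_progs n} \<noteq> {}" by blast
  have "\<bar>\<Sum>x\<in>A. \<chi> x\<bar> \<in> {0..int n}" if "A \<in> arith_progs n" for A
  proof -
    have A: "A \<subseteq> {..<n}" using that assms(1) unfolding arith_progs_def by auto
    have "\<bar>\<Sum>x\<in>A. \<chi> x\<bar> \<le> (\<Sum>x\<in>A. \<bar>\<chi> x\<bar>)" by (rule sum_abs)
    also have "\<dots> = (\<Sum>x\<in>A. 1)" using A assms(2) by (intro sum.cong) fastforce+
    also have "\<dots> \<le> int n" using card_mono[OF _ A] by simp
    finally show ?thesis by simp
  qed
  with Max_in[OF fin ne] show ?thesis by auto
qed

text \<open>Colourings are functions on all naturals, so there are infinitely many, but their maxima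
  are integers between 0 and n. This makes the \<open>Min\<close> in \<open>disc_AP\<close> a
  genuine minimum.\<close>

lemma finite_Max_AP_sums:
  assumes "0 < n"
  shows "finite {Max {\<bar>\<Sum>x\<in>A. \<chi> x\<bar> | A. A \<in> arith_progs n} | \<chi> :: nat \<Rightarrow> int. \<forall>x<n. \<chi> x \<in> {1, -1}}"
  by (rule finite_subset[of _ "{0..int n}"]) (use Max_AP_sums_bounds[OF assms] in \<open>blast | simp\<close>)+

lemma disc_AP_le:
  fixes \<chi> :: "nat \<Rightarrow> int"
  assumes n: "0 < n" and \<chi>: "\<forall>x<n. \<chi> x \<in> {1, -1}"
    and B: "\<And>a d l. l \<le> n div gcd n d \<Longrightarrow> \<bar>real_of_int (\<Sum>k<l. \<chi> ((a + k * d) mod n))\<bar> \<le> B"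
  shows "real_of_int (disc_AP n) \<le> B"
proof -
  let ?S = "{\<bar>\<Sum>x\<in>A. \<chi> x\<bar> | A. A \<in> arith_progs n}"
  have "disc_AP n \<le> Max ?S"
    unfolding disc_AP_def by (rule Min_le[OF finite_Max_AP_sums[OF n]]) (use \<chi> in blast)
  moreover have "Max ?S \<in> ?S"
  proof (rule Max_in)
    show "finite ?S" using finite_arith_progs by simp
    have "{(0 + k * 0) mod n | k. k < 0} \<in> arith_progs n"
      unfolding arith_progs_def using n by blast
    then show "?S \<noteq> {}" by blast
  qed
  then obtain A where A: "A \<in> arith_progs n" "Max ?S = \<bar>\<Sum>x\<in>A. \<chi> x\<bar>" by blast
  then obtain a d l where "A = {(a + k * d) mod n | k. k < l}" "l \<le> n div gcd n d"
    unfolding arith_progs_def by blast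
  then have "real_of_int (Max ?S) \<le> B"
    using B[of l d a] sum_arith_prog[OF n, where l = l and d = d and a = a and \<chi> = \<chi>] A(2) by simp
  ultimately show ?thesis by linarith
qed

lemma disc_AP_obtains_coloring:
  assumes n: "0 < n"
  obtains \<chi> :: "nat \<Rightarrow> int" where "\<forall>x<n. \<chi> x \<in> {1, -1}"
    "\<And>a d l. a < n \<Longrightarrow> d < n \<Longrightarrow> l \<le> n div gcd n d \<Longrightarrow> \<bar>\<Sum>k<l. \<chi> ((a + k * d) mod n)\<bar> \<le> disc_AP n"
proof -
  let ?T = "{Max {\<bar>\<Sum>x\<in>A. \<chi> x\<bar> | A. A \<in> arith_progs n} | \<chi> :: nat \<Rightarrow> int. \<forall>x<n. \<chi> x \<in> {1, -1}}"
  have "\<exists>\<chi> :: nat \<Rightarrow> int. \<forall>x<n. \<chi> x \<in> {1, -1}" by (rule exI[of _ "\<lambda>_. 1"]) simp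
  then have "?T \<noteq> {}" by simp
  then have "disc_AP n \<in> ?T" unfolding disc_AP_def by (rule Min_in[OF finite_Max_AP_sums[OF n]])
  then obtain \<chi> :: "nat \<Rightarrow> int" where \<chi>: "\<forall>x<n. \<chi> x \<in> {1, -1}"
    "disc_AP n = Max {\<bar>\<Sum>x\<in>A. \<chi> x\<bar> | A. A \<in> arith_progs n}" by blast
  have "\<bar>\<Sum>k<l. \<chi> ((a + k * d) mod n)\<bar> \<le> disc_AP n" if "a < n" "d < n" "l \<le> n div gcd n d" for a d l
  proof -
    have "{(a + k * d) mod n | k. k < l} \<in> arith_progs n" unfolding arith_progs_def using that by blast
    then have "\<bar>\<Sum>x\<in>{(a + k * d) mod n | k. k < l}. \<chi> x\<bar> \<le> disc_AP n"
      unfolding \<chi>(2) using finite_arith_progs by (intro Max_ge) (simp, blast)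
    then show ?thesis using sum_arith_prog[OF n that(3), where a = a and \<chi> = \<chi>] by simp
  qed
  with \<chi>(1) show ?thesis by (rule that)
qed

text \<open>A progression of Z_n read modulo r is periodic with period p, the order of d in Z_r.
  Every full period is a coset and contributes at most 1; the remainder is a progression of
  Z_r.\<close>

lemma disc_AP_upper:
  assumes n: "0 < n" and rn: "r dvd n"
  shows "real_of_int (disc_AP n) \<le> real n / real r + 6 * (prefix_const * 2 ^ omega r * sqrt r)"
proof -
  have r: "0 < r" using n rn by (metis dvd_0_left gr0I less_irrefl)
  obtain \<psi> :: "nat \<Rightarrow> int" where \<psi>: "\<forall>x<r. \<psi> x \<in> {1, -1}"
    "\<And>g y. g dvd r \<Longrightarrow> \<bar>\<Sum>x | x < r \<and> x mod g = y. \<psi> x\<bar> \<le> 1"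
    "\<And>a d l. l \<le> r div gcd r d \<Longrightarrow>
        \<bar>\<Sum>k<l. real_of_int (\<psi> ((a + k * d) mod r))\<bar> \<le> 6 * (prefix_const * 2 ^ omega r * sqrt r)"
    using balanced_coloring_exists[OF r] by blast
  show ?thesis
  proof (rule disc_AP_le[OF n, of "\<lambda>x. \<psi> (x mod r)"])
    show "\<forall>x<n. \<psi> (x mod r) \<in> {1, -1}" using \<psi>(1) r by simp
    fix a d l assume l: "l \<le> n div gcd n d"
    define g where "g = gcd r d"
    define p where "p = r div g"
    define F where "F = (\<lambda>k. \<psi> ((a + k * d) mod r))"
    have g: "0 < g" "g dvd r" using r by (auto simp: g_def)
    have rpg: "r = g * p" using g by (simp add: p_def)
    have p0: "0 < p" using r rpg by (cases "p = 0") auto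
    have per: "F (k + p) = F k" for k
      unfolding F_def using ap_mod_eq_iff[OF r, of a "k + p" d k] by (simp add: p_def g_def)
    have "(\<Sum>k<l. \<psi> ((a + k * d) mod n mod r)) = (\<Sum>k<(l div p) * p + l mod p. F k)"
      using rn by (simp add: F_def mod_mod_cancel)
    also have "\<dots> = int (l div p) * (\<Sum>k<p. F k) + (\<Sum>k<l mod p. F k)"
      using per by (rule sum_periodic)
    finally have split: "(\<Sum>k<l. \<psi> ((a + k * d) mod n mod r)) = int (l div p) * (\<Sum>k<p. F k) + (\<Sum>k<l mod p. F k)" .
    have "(\<Sum>k<p. F k) = (\<Sum>x\<in>(\<lambda>k. (a + k * d) mod r) ` {..<p}. \<psi> x)"
      unfolding F_def using sum.reindex[OF inj_on_ap_mod[OF r, of p d a], of \<psi>] by (simp add: p_def g_def)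
    also have "\<dots> = (\<Sum>x | x < r \<and> x mod g = a mod g. \<psi> x)"
      using ap_mod_image_eq_coset[OF r g_def, of a] by (simp add: p_def)
    finally have full: "\<bar>\<Sum>k<p. F k\<bar> \<le> 1" using \<psi>(2)[OF g(2)] by simp
    have part: "\<bar>real_of_int (\<Sum>k<l mod p. F k)\<bar> \<le> 6 * (prefix_const * 2 ^ omega r * sqrt r)"
      using \<psi>(3)[of "l mod p" d a] p0 by (simp add: F_def p_def g_def less_imp_le)
    have q: "real (l div p) \<le> real n / real r"
    proof -
      \<comment> \<open>There are at most n / r full periods because r = g p, where g \<le> gcd n d,
        and l times gcd n d is at most n.\<close>
      have gg: "g \<le> gcd n d" unfolding g_def using rn n by (intro dvd_imp_le gcd_mono) auto
      have "(l div p) * r = (l div p) * p * g" by (simp add: rpg mult_ac)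
      also have "\<dots> \<le> l * g" by (intro mult_right_mono) auto
      also have "\<dots> \<le> (n div gcd n d) * gcd n d" using l gg by (intro mult_mono) auto
      also have "\<dots> = n" by simp
      finally have "real ((l div p) * r) \<le> real n" by (rule of_nat_mono)
      then show ?thesis using r by (simp add: le_divide_eq)
    qed
    have "\<bar>real_of_int (int (l div p) * (\<Sum>k<p. F k))\<bar> = real (l div p) * real_of_int \<bar>\<Sum>k<p. F k\<bar>"
      by (simp add: abs_mult)
    also have "\<dots> \<le> real (l div p) * 1" using full by (intro mult_left_mono) linarith+
    finally have "\<bar>real_of_int (int (l div p) * (\<Sum>k<p. F k))\<bar> \<le> real n / real r" using q by linarith
    with part show "\<bar>real_of_int (\<Sum>k<l. \<psi> ((a + k * d) mod n mod r))\<bar>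
        \<le> real n / real r + 6 * (prefix_const * 2 ^ omega r * sqrt r)"
      unfolding split by linarith
  qed
qed

section \<open>Lower bound\<close>

definition unit_root :: "nat \<Rightarrow> nat \<Rightarrow> complex" where
  "unit_root n k = cis (2 * pi * real k / real n)"

lemma unit_root_0 [simp]: "unit_root n 0 = 1"
  by (simp add: unit_root_def)

lemma unit_root_add: "unit_root n (k + l) = unit_root n k * unit_root n l"
  by (simp add: unit_root_def cis_mult distrib_left add_divide_distrib)

lemma norm_unit_root [simp]: "cmod (unit_root n k) = 1"
  by (simp add: unit_root_def)

lemma unit_root_mult: "unit_root n (k * l) = unit_root n k ^ l"
  by (induction l) (simp_all add: unit_root_add)

lemma unit_root_mult_cnj [simp]: "unit_root n k * cnj (unit_root n k) = 1"
  by (simp add: complex_norm_square[symmetric])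

lemma unit_root_self: "0 < n \<Longrightarrow> unit_root n n = 1"
  by (simp add: unit_root_def)

lemma unit_root_dvd: "0 < n \<Longrightarrow> n dvd k \<Longrightarrow> unit_root n k = 1"
  by (elim dvdE) (simp add: unit_root_mult unit_root_self)

lemma unit_root_mod: "0 < n \<Longrightarrow> unit_root n (k mod n) = unit_root n k"
  by (metis unit_root_add unit_root_dvd dvd_triv_left mult_1 mult_div_mod_eq)

lemma unit_root_cong: "0 < n \<Longrightarrow> k mod n = l mod n \<Longrightarrow> unit_root n k = unit_root n l"
  by (metis unit_root_mod)

lemma unit_root_inj:
  assumes "a < n" "b < n" "unit_root n a = unit_root n b"
  shows "a = b"
proof -
  have "0 < n" using assms(1) by simp
  from bij_betw_roots_unity[OF this] have "inj_on (\<lambda>k. cis (2 * pi * real k / real n)) {..<n}"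
    by (rule bij_betw_imp_inj_on)
  then show ?thesis using assms by (auto simp: unit_root_def inj_on_def)
qed

lemma unit_root_orthogonality:
  assumes "a < n" "b < n"
  shows "(\<Sum>\<xi><n. unit_root n (\<xi> * a) * cnj (unit_root n (\<xi> * b))) = (if a = b then of_nat n else 0)"
proof (cases "a = b")
  case False
  define z where "z = unit_root n a * cnj (unit_root n b)"
  have n: "0 < n" using assms by simp
  have "z \<noteq> 1"
  proof
    assume "z = 1"
    then have "unit_root n a * (cnj (unit_root n b) * unit_root n b) = unit_root n b"
      by (simp add: z_def mult.assoc[symmetric])
    then have "unit_root n a = unit_root n b" by (simp add: mult.commute)
    with False unit_root_inj[OF assms] show False by simp
  qed
  moreover have "z ^ n = 1"
    using n by (simp add: z_def power_mult_distrib unit_root_dvd flip: unit_root_mult complex_cnj_power)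
  moreover have "unit_root n (\<xi> * a) * cnj (unit_root n (\<xi> * b)) = z ^ \<xi>" for \<xi>
    by (simp add: z_def power_mult_distrib mult.commute[of \<xi>] unit_root_mult)
  ultimately show ?thesis using False geometric_sum[of z n] by simp
qed (simp add: mult.commute)

lemma parseval:
  fixes f :: "nat \<Rightarrow> complex"
  shows "(\<Sum>\<xi><n. (cmod (\<Sum>x<n. f x * unit_root n (\<xi> * x)))\<^sup>2) = real n * (\<Sum>x<n. (cmod (f x))\<^sup>2)"
proof -
  have "complex_of_real (\<Sum>\<xi><n. (cmod (\<Sum>x<n. f x * unit_root n (\<xi> * x)))\<^sup>2)
     = (\<Sum>\<xi><n. \<Sum>x<n. \<Sum>y<n. f x * cnj (f y) * (unit_root n (\<xi> * x) * cnj (unit_root n (\<xi> * y))))"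
    by (simp add: complex_norm_square sum_product mult_ac del: of_real_power)
  also have "\<dots> = (\<Sum>x<n. \<Sum>y<n. \<Sum>\<xi><n. f x * cnj (f y) * (unit_root n (\<xi> * x) * cnj (unit_root n (\<xi> * y))))"
    by (subst sum.swap, rule sum.cong, simp, subst sum.swap, simp)
  also have "\<dots> = (\<Sum>x<n. \<Sum>y<n. f x * cnj (f y) * (if x = y then of_nat n else 0))"
    unfolding sum_distrib_left[symmetric] by (intro sum.cong) (auto simp: unit_root_orthogonality)
  also have "\<dots> = (\<Sum>x<n. f x * cnj (f x) * of_nat n)"
    by (intro sum.cong) (auto simp: if_distrib cong: if_cong)
  also have "\<dots> = complex_of_real (real n * (\<Sum>x<n. (cmod (f x))\<^sup>2))"
    by (simp add: complex_norm_square sum_distrib_left mult_ac del: of_real_power)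
  finally show ?thesis using of_real_eq_iff by blast
qed

lemma bij_betw_add_mod:
  fixes n c :: nat
  assumes "0 < n"
  shows "bij_betw (\<lambda>a. (a + c) mod n) {..<n} {..<n}"
proof -
  have "inj_on (\<lambda>a. (a + c) mod n) {..<n}"
  proof (rule inj_onI)
    fix a b assume ab: "a \<in> {..<n}" "b \<in> {..<n}" "(a + c) mod n = (b + c) mod n"
    then have "[a + c = b + c] (mod n)" by (simp add: cong_def)
    then have "[a = b] (mod n)" by (simp only: cong_add_rcancel_nat)
    then show "a = b" using ab by (simp add: cong_def)
  qed
  moreover have "(\<lambda>a. (a + c) mod n) ` {..<n} \<subseteq> {..<n}" using assms by auto
  ultimately show ?thesis by (metis bij_betw_def finite_lessThan endo_inj_surj)
qed

definition dft :: "nat \<Rightarrow> (nat \<Rightarrow> int) \<Rightarrow> nat \<Rightarrow> complex" where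
  "dft n \<chi> \<xi> = (\<Sum>x<n. of_int (\<chi> x) * unit_root n (\<xi> * x))"

text \<open>As a function of the starting point a, the sum over the progression is a correlation of
  \<open>\<chi>\<close> with the progression through 0. Its transform is \<open>dft\<close> times
  the conjugate of an exponential sum, and Parseval applies.\<close>

lemma sum_ap_squares_eq:
  fixes \<chi> :: "nat \<Rightarrow> int"
  assumes n: "0 < n"
  shows "real n * (\<Sum>a<n. (real_of_int (\<Sum>k<l. \<chi> ((a + k * d) mod n)))\<^sup>2)
    = (\<Sum>\<xi><n. (cmod (dft n \<chi> \<xi>))\<^sup>2 * (cmod (\<Sum>k<l. unit_root n (\<xi> * (k * d))))\<^sup>2)"
proof -
  define G where "G = (\<lambda>a. \<Sum>k<l. \<chi> ((a + k * d) mod n))"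
  have ftG: "(\<Sum>a<n. of_int (G a) * unit_root n (\<xi> * a)) = dft n \<chi> \<xi> * cnj (\<Sum>k<l. unit_root n (\<xi> * (k * d)))" for \<xi>
  proof -
    have inner: "(\<Sum>a<n. of_int (\<chi> ((a + c) mod n)) * unit_root n (\<xi> * a)) = dft n \<chi> \<xi> * cnj (unit_root n (\<xi> * c))" for c
    proof -
      have ur: "unit_root n (\<xi> * a) = unit_root n (\<xi> * ((a + c) mod n)) * cnj (unit_root n (\<xi> * c))" for a
      proof -
        have "unit_root n (\<xi> * ((a + c) mod n)) = unit_root n (\<xi> * (a + c))"
          using n by (intro unit_root_cong) (auto simp: mod_mult_right_eq)
        then show ?thesis by (simp add: distrib_left unit_root_add mult.assoc)
      qed
      have "(\<Sum>a<n. of_int (\<chi> ((a + c) mod n)) * unit_root n (\<xi> * a))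
          = (\<Sum>a<n. (\<lambda>x. of_int (\<chi> x) * unit_root n (\<xi> * x) * cnj (unit_root n (\<xi> * c))) ((a + c) mod n))"
        by (rule sum.cong[OF refl]) (subst ur, simp add: mult.assoc)
      also have "\<dots> = (\<Sum>x<n. of_int (\<chi> x) * unit_root n (\<xi> * x) * cnj (unit_root n (\<xi> * c)))"
        by (rule sum.reindex_bij_betw[OF bij_betw_add_mod[OF n]])
      finally show ?thesis by (simp add: dft_def sum_distrib_right)
    qed
    have "(\<Sum>a<n. of_int (G a) * unit_root n (\<xi> * a))
        = (\<Sum>a<n. \<Sum>k<l. of_int (\<chi> ((a + k * d) mod n)) * unit_root n (\<xi> * a))"
      by (simp add: G_def sum_distrib_right)
    also have "\<dots> = (\<Sum>k<l. \<Sum>a<n. of_int (\<chi> ((a + k * d) mod n)) * unit_root n (\<xi> * a))"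
      by (rule sum.swap)
    also have "\<dots> = dft n \<chi> \<xi> * cnj (\<Sum>k<l. unit_root n (\<xi> * (k * d)))"
      by (simp add: inner sum_distrib_left)
    finally show ?thesis .
  qed
  have "real n * (\<Sum>a<n. (real_of_int (G a))\<^sup>2) = real n * (\<Sum>a<n. (cmod (of_int (G a)))\<^sup>2)"
    by simp
  also have "\<dots> = (\<Sum>\<xi><n. (cmod (dft n \<chi> \<xi> * cnj (\<Sum>k<l. unit_root n (\<xi> * (k * d)))))\<^sup>2)"
    unfolding parseval[symmetric] ftG ..
  also have "\<dots> = (\<Sum>\<xi><n. (cmod (dft n \<chi> \<xi>))\<^sup>2 * (cmod (\<Sum>k<l. unit_root n (\<xi> * (k * d))))\<^sup>2)"
    by (simp only: norm_mult complex_mod_cnj power_mult_distrib)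
  finally show ?thesis by (simp add: G_def)
qed

text \<open>Rotate so that the middle term k = q, with q = r div 6, has angle 0. All angles are then
  at most pi / 3 in modulus, so every cosine is at least 1/2 and the middle one is 1. The sum is at
  least (2q + 1) / 2 + 1/2 = q + 1 \<ge> r / 6.\<close>

lemma cmod_sum_cis_ge:
  fixes r :: nat
  assumes "0 < r"
  shows "real r / 6 \<le> cmod (\<Sum>k<2 * (r div 6) + 1. cis (2 * pi * real k / real r))"
proof -
  define q where "q = r div 6"
  define \<theta> where "\<theta> = 2 * pi / real r"
  have "6 * q \<le> r" by (simp add: q_def)
  then have "6 * real q \<le> real r" by (metis of_nat_le_iff of_nat_mult of_nat_numeral)
  then have q\<theta>: "real q * \<theta> \<le> pi / 3" using assms by (simp add: \<theta>_def field_simps)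
  have \<theta>: "0 \<le> \<theta>" by (simp add: \<theta>_def)
  have half: "1 / 2 \<le> cos ((real k - real q) * \<theta>)" if "k < 2 * q + 1" for k
  proof -
    have "\<bar>real k - real q\<bar> \<le> real q" using that by linarith
    then have "\<bar>(real k - real q) * \<theta>\<bar> \<le> real q * \<theta>" using \<theta> by (simp add: abs_mult mult_right_mono)
    then have "\<bar>(real k - real q) * \<theta>\<bar> \<le> pi / 3" using q\<theta> by linarith
    then have "cos (pi / 3) \<le> cos \<bar>(real k - real q) * \<theta>\<bar>" by (intro cos_monotone_0_pi_le) auto
    then show ?thesis by (simp add: cos_60 del: abs_mult)
  qed
  have "real r / 6 \<le> 1 + real q"
  proof -
    have "r \<le> 6 * q + 6" by (simp add: q_def)
    then have "real r \<le> real (6 * q + 6)" using of_nat_le_iff by blast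
    then show ?thesis by simp
  qed
  also have "1 + real q = (\<Sum>k<2 * q + 1. 1 / 2 + (if k = q then 1 / 2 else 0))"
    unfolding sum.distrib by (simp add: field_simps)
  also have "\<dots> \<le> (\<Sum>k<2 * q + 1. cos ((real k - real q) * \<theta>))"
    using half by (intro sum_mono) auto
  also have "\<dots> = Re (cis (- (real q * \<theta>)) * (\<Sum>k<2 * q + 1. cis (real k * \<theta>)))"
    by (simp add: sum_distrib_left cis_mult Re_sum algebra_simps)
  also have "\<dots> \<le> cmod (cis (- (real q * \<theta>)) * (\<Sum>k<2 * q + 1. cis (real k * \<theta>)))" by (rule complex_Re_le_cmod)
  also have "\<dots> = cmod (\<Sum>k<2 * q + 1. cis (2 * pi * real k / real r))"
    by (simp add: norm_mult \<theta>_def mult_ac)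
  finally show ?thesis by (simp add: q_def)
qed

text \<open>Write \<xi> = h u with u coprime to r and let d be the inverse of u modulo r. Then \<xi>
  k d / n and k / r agree modulo 1, which leaves the sum of \<open>cmod_sum_cis_ge\<close>.\<close>

lemma exists_step_resonant:
  assumes n: "n = h * r" "0 < h" "0 < r" and \<xi>: "gcd \<xi> n = h"
  shows "\<exists>d<r. coprime d r \<and> real r / 6 \<le> cmod (\<Sum>k<2 * (r div 6) + 1. unit_root n (\<xi> * (k * d)))"
proof -
  obtain u where u: "\<xi> = h * u" using \<xi> by (metis dvdE gcd_dvd1)
  have "h * gcd u r = h * 1" using \<xi> n(1) gcd_mult_distrib_nat[of h u r] by (simp add: u)
  then have "coprime u r" using n(2) by (simp add: coprime_iff_gcd_eq_1)
  then obtain x where x: "[u * x = 1] (mod r)" using cong_solve_coprime_nat[of u r] by auto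
  define d where "d = x mod r"
  have ud: "[u * d = 1] (mod r)" using x by (simp add: d_def cong_def mod_mult_right_eq)
  have "coprime (u * d) r" using ud by (metis cong_imp_coprime cong_sym coprime_1_left)
  then have "coprime d r" by simp
  moreover have "d < r" using n by (simp add: d_def)
  moreover have "unit_root n (\<xi> * (k * d)) = cis (2 * pi * real k / real r)" for k
  proof -
    have "[h * (k * (u * d)) = h * (k * 1)] (mod h * r)"
      using ud n by (intro cong_scalar_left cong_cmult_leftI) auto
    then have "unit_root n (\<xi> * (k * d)) = unit_root n (h * k)"
      using n by (intro unit_root_cong) (auto simp: cong_def u mult_ac)
    also have "\<dots> = cis (2 * pi * real k / real r)" using n by (simp add: unit_root_def mult.assoc)
    finally show ?thesis .
  qed
  ultimately show ?thesis using cmod_sum_cis_ge[OF n(3)] by auto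
qed

lemma fourier_mass_concentrates:
  fixes \<chi> :: "nat \<Rightarrow> int"
  assumes n: "0 < n" and \<chi>: "\<forall>x<n. \<chi> x \<in> {1, -1}"
  obtains h where "h dvd n"
    "real n * real n \<le> real (num_divisors n) * (\<Sum>\<xi> | \<xi> < n \<and> gcd \<xi> n = h. (cmod (dft n \<chi> \<xi>))\<^sup>2)"
proof -
  define M where "M = (\<lambda>h. \<Sum>\<xi> | \<xi> \<in> {..<n} \<and> gcd \<xi> n = h. (cmod (dft n \<chi> \<xi>))\<^sup>2)"
  let ?D = "{h. h dvd n}"
  have fin: "finite ?D" using n by simp
  have "(\<Sum>h\<in>?D. M h) = (\<Sum>\<xi><n. (cmod (dft n \<chi> \<xi>))\<^sup>2)"
    unfolding M_def using sum.group[of "{..<n}" ?D "\<lambda>\<xi>. gcd \<xi> n" "\<lambda>\<xi>. (cmod (dft n \<chi> \<xi>))\<^sup>2"] fin by auto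
  also have "\<dots> = real n * (\<Sum>x<n. (cmod (of_int (\<chi> x)))\<^sup>2)"
    unfolding dft_def by (rule parseval)
  also have "(\<Sum>x<n. (cmod (of_int (\<chi> x)))\<^sup>2) = (\<Sum>x<n. 1)"
    using \<chi> by (intro sum.cong) fastforce+
  finally have total: "(\<Sum>h\<in>?D. M h) = real n * real n" by simp
  have "\<exists>h\<in>?D. real n * real n \<le> real (num_divisors n) * M h"
  proof (rule ccontr)
    assume "\<not> ?thesis"
    then have less: "real (num_divisors n) * M h < real n * real n" if "h \<in> ?D" for h using that by force
    have "real (num_divisors n) * (\<Sum>h\<in>?D. M h) < (\<Sum>h\<in>?D. real n * real n)"
      unfolding sum_distrib_left using fin less by (intro sum_strict_mono) auto
    then show False unfolding total by (simp add: num_divisors_def)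
  qed
  then show ?thesis using that by (auto simp: M_def)
qed

text \<open>Both bounds hold for the same divisor r, namely n / h for the heavy frequency class h,
  so they may be added to bound n / r + sqrt r.\<close>

lemma disc_AP_lower_aux:
  fixes \<chi> :: "nat \<Rightarrow> int" and D :: real
  assumes n: "0 < n" and \<chi>: "\<forall>x<n. \<chi> x \<in> {1, -1}" and D0: "0 \<le> D"
    and D: "\<And>a d l. a < n \<Longrightarrow> d < n \<Longrightarrow> l \<le> n div gcd n d \<Longrightarrow> \<bar>real_of_int (\<Sum>k<l. \<chi> ((a + k * d) mod n))\<bar> \<le> D"
  shows "\<exists>r. r dvd n \<and> real n / real r \<le> D * sqrt (num_divisors n) \<and> sqrt r \<le> 6 * (D * sqrt (num_divisors n))"
proof -
  define N where "N = real (num_divisors n)"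
  obtain h where h: "h dvd n"
    "real n * real n \<le> N * (\<Sum>\<xi> | \<xi> < n \<and> gcd \<xi> n = h. (cmod (dft n \<chi> \<xi>))\<^sup>2)"
    using fourier_mass_concentrates[OF n \<chi>] unfolding N_def by blast
  define \<Xi> where "\<Xi> = {\<xi>. \<xi> < n \<and> gcd \<xi> n = h}"
  define M where "M = (\<Sum>\<xi>\<in>\<Xi>. (cmod (dft n \<chi> \<xi>))\<^sup>2)"
  define W where "W = (\<lambda>d l \<xi>. cmod (\<Sum>k<l. unit_root n (\<xi> * (k * d))))"
  obtain r where r: "n = h * r" using h(1) by (elim dvdE)
  have hr: "0 < h" "0 < r" using n r by auto
  have N: "0 \<le> N" by (simp add: N_def)
  have NM: "real n * real n \<le> N * M" using h(2) by (simp add: M_def \<Xi>_def)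
  \<comment> \<open>For a fixed difference and length, the mean square over all starting points is
    at most D^2; on the Fourier side only the heavy class is kept.\<close>
  have energy: "(\<Sum>\<xi>\<in>\<Xi>. (cmod (dft n \<chi> \<xi>))\<^sup>2 * (W d l \<xi>)\<^sup>2) \<le> (real n * D)\<^sup>2"
    if d: "d < n" "l \<le> n div gcd n d" for d l
  proof -
    have "(\<Sum>\<xi>\<in>\<Xi>. (cmod (dft n \<chi> \<xi>))\<^sup>2 * (W d l \<xi>)\<^sup>2) \<le> (\<Sum>\<xi><n. (cmod (dft n \<chi> \<xi>))\<^sup>2 * (W d l \<xi>)\<^sup>2)"
      by (intro sum_mono2) (auto simp: \<Xi>_def)
    also have "\<dots> = real n * (\<Sum>a<n. (real_of_int (\<Sum>k<l. \<chi> ((a + k * d) mod n)))\<^sup>2)"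
      unfolding W_def by (rule sum_ap_squares_eq[OF n, symmetric])
    also have "\<dots> \<le> real n * (\<Sum>a<n. D\<^sup>2)"
      using D[OF _ d] D0 by (intro mult_left_mono sum_mono) (auto simp flip: abs_le_square_iff simp del: of_int_sum)
    also have "\<dots> = (real n * D)\<^sup>2" by (simp add: power2_eq_square)
    finally show ?thesis .
  qed
  have "real n / real r \<le> D * sqrt N"
  proof -
    \<comment> \<open>A difference must be below n, and r = n is possible; reducing modulo n
      preserves the gcd.\<close>
    have gr: "gcd n (r mod n) = r" using r n gcd_mod_right[of n r] by simp
    have W1: "W (r mod n) h \<xi> = real h" if "\<xi> \<in> \<Xi>" for \<xi>
    proof -
      have "unit_root n (\<xi> * (k * (r mod n))) = 1" for k
      proof (rule unit_root_dvd[OF n])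
        have "h dvd \<xi>" using that by (auto simp: \<Xi>_def)
        then have "n dvd \<xi> * r" using r by (simp add: mult_dvd_mono)
        then have "n dvd (\<xi> * k) * r" by (metis dvd_mult2 mult.assoc mult.commute)
        then show "n dvd \<xi> * (k * (r mod n))" by (simp add: dvd_eq_mod_eq_0 mod_mult_right_eq mult.assoc[symmetric])
      qed
      then show ?thesis by (simp add: W_def)
    qed
    have "M * (real h)\<^sup>2 = (\<Sum>\<xi>\<in>\<Xi>. (cmod (dft n \<chi> \<xi>))\<^sup>2 * (W (r mod n) h \<xi>)\<^sup>2)"
      by (simp add: M_def sum_distrib_right W1)
    also have "\<dots> \<le> (real n * D)\<^sup>2" using n hr r gr by (intro energy) auto
    finally have "N * (M * (real h)\<^sup>2) \<le> N * (real n * D)\<^sup>2" using N by (rule mult_left_mono)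
    moreover have "(real n * real n) * (real h)\<^sup>2 \<le> (N * M) * (real h)\<^sup>2" using NM by (rule mult_right_mono) simp
    ultimately have "(real n * real n) * (real h)\<^sup>2 \<le> (real n * real n) * (N * D\<^sup>2)"
      by (simp add: power2_eq_square mult_ac)
    then have "(real h)\<^sup>2 \<le> N * D\<^sup>2" using n by simp
    then have "sqrt ((real h)\<^sup>2) \<le> sqrt (N * D\<^sup>2)" by (rule real_sqrt_le_mono)
    then have "real h \<le> D * sqrt N" using D0 by (simp add: real_sqrt_mult mult.commute)
    then show ?thesis using r hr by simp
  qed
  moreover have "sqrt r \<le> 6 * (D * sqrt N)"
  proof -
    define l where "l = 2 * (r div 6) + 1"
    define E where "E = {d. d < r \<and> coprime d r}"
    have finE: "finite E" by (simp add: E_def)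
    have "card E \<le> card {..<r}" by (rule card_mono) (auto simp: E_def)
    then have cardE: "real (card E) \<le> real r" by simp
    \<comment> \<open>A difference coprime to r has its gcd with n = h r dividing h, so progressions
      of length up to r, and in particular l, are allowed.\<close>
    have El: "d < n" "l \<le> n div gcd n d" if "d \<in> E" for d
    proof -
      have "r \<le> n" using r hr by simp
      then show "d < n" using that by (simp add: E_def)
      have "coprime d r" using that by (simp add: E_def)
      have "gcd n d dvd h * r" using r by simp
      moreover have "coprime (gcd n d) r" using \<open>coprime d r\<close> by (meson coprime_divisors dvd_refl gcd_dvd2)
      ultimately have "gcd n d dvd h" by (simp add: coprime_dvd_mult_left_iff)
      then have "gcd n d \<le> h" using hr by (simp add: dvd_imp_le)
      then have "n div h \<le> n div gcd n d" using n by (intro div_le_mono2) auto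
      moreover have "l \<le> r" unfolding l_def using hr by presburger
      ultimately show "l \<le> n div gcd n d" using r hr by simp
    qed
    \<comment> \<open>Each frequency of the class finds its own resonant d in \<open>E\<close>;
      summing over all of \<open>E\<close> serves them simultaneously. The gain is r^2 / 36 against
      a loss of card E \<le> r, which leaves r / 36.\<close>
    have "M * (real r / 6)\<^sup>2 \<le> (\<Sum>\<xi>\<in>\<Xi>. (cmod (dft n \<chi> \<xi>))\<^sup>2 * (\<Sum>d\<in>E. (W d l \<xi>)\<^sup>2))"
      unfolding M_def sum_distrib_right
    proof (intro sum_mono mult_left_mono)
      fix \<xi> assume "\<xi> \<in> \<Xi>"
      then have "gcd \<xi> n = h" by (simp add: \<Xi>_def)
      from exists_step_resonant[OF r hr this] obtain d where d: "d \<in> E" "real r / 6 \<le> W d l \<xi>"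
        by (auto simp: E_def W_def l_def)
      have "(real r / 6)\<^sup>2 \<le> (W d l \<xi>)\<^sup>2" using d(2) by (intro power_mono) auto
      also have "\<dots> \<le> (\<Sum>d\<in>E. (W d l \<xi>)\<^sup>2)" using d(1) finE by (intro member_le_sum) auto
      finally show "(real r / 6)\<^sup>2 \<le> (\<Sum>d\<in>E. (W d l \<xi>)\<^sup>2)" .
    qed simp
    also have "\<dots> = (\<Sum>d\<in>E. \<Sum>\<xi>\<in>\<Xi>. (cmod (dft n \<chi> \<xi>))\<^sup>2 * (W d l \<xi>)\<^sup>2)"
      unfolding sum_distrib_left by (rule sum.swap)
    also have "\<dots> \<le> (\<Sum>d\<in>E. (real n * D)\<^sup>2)" by (intro sum_mono energy El)
    also have "\<dots> = real (card E) * (real n * D)\<^sup>2" by simp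
    also have "\<dots> \<le> real r * (real n * D)\<^sup>2" using cardE by (rule mult_right_mono) simp
    finally have "N * (M * (real r / 6)\<^sup>2) \<le> N * (real r * (real n * D)\<^sup>2)" using N by (rule mult_left_mono)
    moreover have "(real n * real n) * (real r / 6)\<^sup>2 \<le> (N * M) * (real r / 6)\<^sup>2" using NM by (rule mult_right_mono) simp
    ultimately have "(real n * real n) * (real r / 6)\<^sup>2 \<le> N * (real r * (real n * D)\<^sup>2)"
      by (simp only: mult.assoc)
    then have "(real n * real n * real r) * (real r / 36) \<le> (real n * real n * real r) * (N * D\<^sup>2)"
      by (simp add: power2_eq_square mult_ac)
    then have "real r / 36 \<le> N * D\<^sup>2" using n hr by (subst (asm) mult_le_cancel_left_pos) auto
    then have "real r \<le> 6\<^sup>2 * (N * D\<^sup>2)" by simp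
    then have "sqrt r \<le> sqrt (6\<^sup>2 * (N * D\<^sup>2))" by (rule real_sqrt_le_mono)
    also have "\<dots> = 6 * (D * sqrt N)" using D0 by (simp add: real_sqrt_mult mult.commute)
    finally show ?thesis .
  qed
  moreover have "r dvd n" using r by simp
  ultimately show ?thesis unfolding N_def by blast
qed

theorem theorem1p1:
  "\<exists>c::real > 0. \<forall>n::nat. n > 0 \<longrightarrow>
     1 / (8 * sqrt (real (num_divisors n))) *
       Min {real n / real r + sqrt (real r) | r. r dvd n}
       \<le> real_of_int (disc_AP n)
     \<and> real_of_int (disc_AP n)
       \<le> Min {real n / real r + c * sqrt (real r) * 2 ^ omega r | r. r dvd n}"
proof (intro exI[of _ "6 * prefix_const + 1"] conjI allI impI)
  \<comment> \<open>The 6 comes from \<open>abs_ap_sum_le_of_prefix_bound\<close>; the added 1 gives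
    strict positivity from the nonnegativity of \<open>prefix_const\<close>.\<close>
  show "0 < 6 * prefix_const + 1" using prefix_const_nonneg by simp
next
  fix n :: nat assume n: "n > 0"
  have fin: "finite {f r | r. r dvd n}" for f :: "nat \<Rightarrow> real" using n by simp
  obtain \<chi> :: "nat \<Rightarrow> int" where \<chi>: "\<forall>x<n. \<chi> x \<in> {1, -1}"
    "\<And>a d l. a < n \<Longrightarrow> d < n \<Longrightarrow> l \<le> n div gcd n d \<Longrightarrow> \<bar>\<Sum>k<l. \<chi> ((a + k * d) mod n)\<bar> \<le> disc_AP n"
    using disc_AP_obtains_coloring[OF n] by blast
  define D where "D = real_of_int (disc_AP n)"
  define s where "s = sqrt (real (num_divisors n))"
  \<comment> \<open>The empty progression, of length 0, already shows this.\<close>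
  have D0: "0 \<le> D" using \<chi>(2)[of 0 0 0] n by (simp add: D_def)
  have "\<bar>real_of_int (\<Sum>k<l. \<chi> ((a + k * d) mod n))\<bar> \<le> D"
    if "a < n" "d < n" "l \<le> n div gcd n d" for a d l
    using \<chi>(2)[OF that] unfolding D_def by linarith
  from disc_AP_lower_aux[OF n \<chi>(1) D0 this]
  obtain r where r: "r dvd n" "real n / real r \<le> D * s" "sqrt r \<le> 6 * (D * s)"
    unfolding s_def by blast
  have "0 < num_divisors n" using n by (auto simp: num_divisors_def card_gt_0_iff)
  then have s: "0 < s" by (simp add: s_def)
  have "Min {real n / real r + sqrt (real r) | r. r dvd n} \<le> real n / real r + sqrt r"
    using fin r(1) by (intro Min_le) auto
  \<comment> \<open>One multiple of D s from n / r and six from sqrt r; the 7 is then relaxed to the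
    stated 8.\<close>
  also have "\<dots> \<le> 7 * (D * s)" using r by simp
  also have "\<dots> \<le> 8 * (D * s)" using D0 s by simp
  finally have "1 / (8 * s) * Min {real n / real r + sqrt (real r) | r. r dvd n} \<le> 1 / (8 * s) * (8 * (D * s))"
    using s by (intro mult_left_mono) auto
  then show "1 / (8 * sqrt (real (num_divisors n))) * Min {real n / real r + sqrt (real r) | r. r dvd n}
      \<le> real_of_int (disc_AP n)"
    using s by (simp add: D_def s_def[symmetric])
  show "real_of_int (disc_AP n)
      \<le> Min {real n / real r + (6 * prefix_const + 1) * sqrt (real r) * 2 ^ omega r | r. r dvd n}"
  proof (rule Min.boundedI)
    show "finite {real n / real r + (6 * prefix_const + 1) * sqrt (real r) * 2 ^ omega r | r. r dvd n}"
      by (rule fin)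
    show "{real n / real r + (6 * prefix_const + 1) * sqrt (real r) * 2 ^ omega r | r. r dvd n} \<noteq> {}"
      by auto
    fix z assume "z \<in> {real n / real r + (6 * prefix_const + 1) * sqrt (real r) * 2 ^ omega r | r. r dvd n}"
    then obtain r where "r dvd n" and z: "z = real n / real r + (6 * prefix_const + 1) * sqrt (real r) * 2 ^ omega r"
      by blast
    from disc_AP_upper[OF n this(1)] have "real_of_int (disc_AP n)
        \<le> real n / real r + 6 * prefix_const * sqrt r * 2 ^ omega r" by (simp add: mult_ac)
    also have "\<dots> \<le> real n / real r + (6 * prefix_const + 1) * sqrt r * 2 ^ omega r"
      by (intro add_left_mono mult_right_mono) auto
    finally show "real_of_int (disc_AP n) \<le> z" by (simp add: z)
  qed
qed

end
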